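(* Let $E$ be a Polish space with Borel $\sigma$-algebra $\mathcal{B}$ and $(P_t)_{t\ge0}$ a measurable Markovian transition function on $(E,\mathcal{B})$ with the Feller property ($P_t$ maps bounded continuous functions to bounded continuous functions), with resolvent $R_\alpha f=\int_0^\infty e^{-\alpha t}P_tf\,dt$. Assume there exist a compact set $K\subset E$ and a probability measure $\nu$ such that $$\limsup_{t\to\infty}\frac1t\int_0^t\nu(P_s1_K)\,ds>\frac12.$$ Choose $t_n\nearrow\infty$ with $\frac1{t_n}\int_0^{t_n}\nu(P_s1_K)\,ds>\frac12$ for all $n$, let $\mu^K_n(f):=\frac1{t_n}\int_0^{t_n}\nu(P_s(1_Kf))\,ds$, let $\mu$ be a weak limit of a subsequence $(\mu^K_{n_k})_k$, fix $\alpha>0$, and define $m(f):=\mu(\alpha R_\alpha f)$ for positive measurable $f$. Then $m$ is almost invariant for $(P_t)_{t\ge0}$; hence there exists an invariant measure for $(P_t)_{t\ge0}$ which is absolutely continuous with respect to $m$.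
   Context: The family $(\mu^K_n)_n$ is tight, so such a weakly convergent subsequence exists. A finite positive measure $m$ is almost invariant if $m(f)=0$ implies $m(P_tf)=0$ for all $t>0$ and positive measurable $f$, and there exist $\delta\in[0,1)$ and $\phi:\mathcal{B}\to\mathbb{R}_+$ with $\lim_{m(A)\to0}\phi(A)=0$ such that $m(P_t1_A)\le\delta m(E)+\phi(A)$ for all $t>0$, $A\in\mathcal{B}$. An invariant measure is a nonzero finite positive measure $\eta$ with $\int P_tf\,d\eta=\int f\,d\eta$ for all $t>0$ and bounded measurable $f$. *)

theory Defs
  imports "HOL-Probability.Probability"
begin

definition markov_tf :: "(real \<Rightarrow> 'a::polish_space \<Rightarrow> 'a measure) \<Rightarrow> bool" where
  "markov_tf P \<longleftrightarrow>
     (\<forall>t\<ge>0. \<forall>x. sets (P t x) = sets borel \<and> prob_space (P t x)) \<and>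
     (\<forall>A\<in>sets borel. (\<lambda>z. emeasure (P (fst z) (snd z)) A)
         \<in> borel_measurable (restrict_space borel ({0..} \<times> UNIV))) \<and>
     (\<forall>s\<ge>0. \<forall>t\<ge>0. \<forall>x. \<forall>A\<in>sets borel.
         emeasure (P (s + t) x) A = (\<integral>\<^sup>+ y. emeasure (P t y) A \<partial>P s x))"

definition feller :: "(real \<Rightarrow> 'a::polish_space \<Rightarrow> 'a measure) \<Rightarrow> bool" where
  "feller P \<longleftrightarrow> (\<forall>t\<ge>0. \<forall>f::'a \<Rightarrow> real. continuous_on UNIV f \<and> bounded (range f) \<longrightarrow>
       continuous_on UNIV (\<lambda>x. \<integral> y. f y \<partial>P t x))"

definition resolvent :: "(real \<Rightarrow> 'a \<Rightarrow> 'a measure) \<Rightarrow> real \<Rightarrow> ('a \<Rightarrow> ennreal) \<Rightarrow> 'a \<Rightarrow> ennreal" where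
  "resolvent P \<alpha> f x = (\<integral>\<^sup>+ t\<in>{0..}. ennreal (exp (- \<alpha> * t)) * (\<integral>\<^sup>+ y. f y \<partial>P t x) \<partial>lborel)"

definition nuP :: "(real \<Rightarrow> 'a \<Rightarrow> 'a measure) \<Rightarrow> 'a measure \<Rightarrow> real \<Rightarrow> 'a set \<Rightarrow> real" where
  "nuP P \<nu> s A = (\<integral> x. measure (P s x) A \<partial>\<nu>)"

definition time_avg :: "(real \<Rightarrow> 'a \<Rightarrow> 'a measure) \<Rightarrow> 'a measure \<Rightarrow> real \<Rightarrow> 'a set \<Rightarrow> real" where
  "time_avg P \<nu> T A = (1 / T) * (LBINT s=0..T. nuP P \<nu> s A)"

definition muK :: "(real \<Rightarrow> 'a::polish_space \<Rightarrow> 'a measure) \<Rightarrow> 'a measure \<Rightarrow> 'a set \<Rightarrow> real \<Rightarrow> 'a measure" where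
  "muK P \<nu> K T = measure_of UNIV (sets borel) (\<lambda>A. ennreal (time_avg P \<nu> T (K \<inter> A)))"

definition weak_conv_meas :: "(nat \<Rightarrow> 'a::topological_space measure) \<Rightarrow> 'a measure \<Rightarrow> bool" where
  "weak_conv_meas M N \<longleftrightarrow> (\<forall>f::'a \<Rightarrow> real. continuous_on UNIV f \<and> bounded (range f) \<longrightarrow>
       (\<lambda>k. \<integral> x. f x \<partial>M k) \<longlonglongrightarrow> (\<integral> x. f x \<partial>N))"

definition resolvent_measure :: "(real \<Rightarrow> 'a::polish_space \<Rightarrow> 'a measure) \<Rightarrow> real \<Rightarrow> 'a measure \<Rightarrow> 'a measure" where
  "resolvent_measure P \<alpha> \<mu> = measure_of UNIV (sets borel)
      (\<lambda>A. \<integral>\<^sup>+ x. ennreal \<alpha> * resolvent P \<alpha> (indicator A) x \<partial>\<mu>)"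

definition almost_invariant :: "(real \<Rightarrow> 'a::polish_space \<Rightarrow> 'a measure) \<Rightarrow> 'a measure \<Rightarrow> bool" where
  "almost_invariant P m \<longleftrightarrow> sets m = sets borel \<and> finite_measure m \<and>
     (\<forall>t>0. \<forall>f \<in> borel_measurable borel. (\<integral>\<^sup>+ x. f x \<partial>m) = 0 \<longrightarrow>
         (\<integral>\<^sup>+ x. (\<integral>\<^sup>+ y. f y \<partial>P t x) \<partial>m) = 0) \<and>
     (\<exists>\<delta>::real. 0 \<le> \<delta> \<and> \<delta> < 1 \<and> (\<exists>\<phi>::'a set \<Rightarrow> real.
        (\<forall>A\<in>sets borel. 0 \<le> \<phi> A) \<and>
        (\<forall>\<epsilon>>0. \<exists>\<eta>>0. \<forall>A\<in>sets borel. measure m A < \<eta> \<longrightarrow> \<phi> A < \<epsilon>) \<and>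
        (\<forall>t>0. \<forall>A\<in>sets borel.
           (\<integral>\<^sup>+ x. emeasure (P t x) A \<partial>m) \<le> ennreal (\<delta> * measure m (space m) + \<phi> A))))"

definition invariant_measure :: "(real \<Rightarrow> 'a::polish_space \<Rightarrow> 'a measure) \<Rightarrow> 'a measure \<Rightarrow> bool" where
  "invariant_measure P \<eta> \<longleftrightarrow> sets \<eta> = sets borel \<and> finite_measure \<eta> \<and> emeasure \<eta> (space \<eta>) \<noteq> 0 \<and>
     (\<forall>t>0. \<forall>f::'a \<Rightarrow> real. f \<in> borel_measurable borel \<and> bounded (range f) \<longrightarrow>
        (\<integral> x. (\<integral> y. f y \<partial>P t x) \<partial>\<eta>) = (\<integral> x. f x \<partial>\<eta>))"

end

theory Submission
  imports Defs
begin

text \<open>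
  Write \<open>\<mu>\<^sub>T\<close> for the occupation measure of \<open>\<nu>\<close> up to time \<open>T\<close>, so that the measures converging to \<open>\<mu>\<close>
  are \<open>1\<^sub>K \<mu>\<^sub>T \<le> \<mu>\<^sub>T\<close>. Since \<open>\<mu>\<^sub>T P\<^sub>t\<close> and \<open>\<mu>\<^sub>T\<close> differ by \<open>O(t / T)\<close>, the Feller property gives
  \<open>\<Sum>\<^sub>j \<mu>(P\<^bsub>t j\<^esub> f\<^sub>j) \<le> 1\<close> for every finite continuous subpartition of unity, hence
  \<open>\<Sum>\<^sub>j m(P\<^bsub>t j\<^esub> 1\<^bsub>A j\<^esub>) \<le> 1\<close> for disjoint Borel sets \<open>A j\<close>. This says that the lattice supremum
  \<open>\<pi>\<^sub>r = sup {m P\<^sub>t | t \<ge> r}\<close> in the space of measures has mass at most \<open>1\<close>.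

  As \<open>m P\<^sub>t \<le> exp (\<alpha> t) m\<close>, the finite measure \<open>\<pi>\<^sub>0\<close> is absolutely continuous with respect to \<open>m\<close>, so
  \<open>m\<close> is almost invariant with \<open>\<delta> = 0\<close> and \<open>\<phi> = \<pi>\<^sub>0\<close>. The more obvious
  constant \<open>\<delta> = (1 - \<mu>(E)) / \<mu>(E)\<close> would not do: the averages along the chosen times may decrease to \<open>1/2\<close>,
  and then \<open>\<delta> = 1\<close>. Finally
  \<open>\<pi>\<^bsub>r+s\<^esub> \<le> \<pi>\<^sub>r P\<^sub>s\<close>, so the decreasing limit \<open>\<eta>\<close> of \<open>\<pi>\<^sub>r\<close> satisfies \<open>\<eta> \<le> \<eta> P\<^sub>s\<close>; both sides have the
  same finite mass, so \<open>\<eta>\<close> is invariant, and its mass is at least that of \<open>m\<close>.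
\<close>

section \<open>Suprema of measures\<close>

text \<open>The supremum optimises over all ways of splitting \<open>A\<close> along a set
  \<open>Z\<close> and measuring one part by \<open>M\<close>, the other by \<open>N\<close>.
  Cutting \<open>A\<close> by both \<open>Z\<close> and the Hahn set \<open>Y\<close> gives four
  pieces, and wherever \<open>Z\<close> and \<open>Y\<close> disagree, following \<open>Y\<close>
  picks the larger measure.\<close>

lemma emeasure_sup_le_Hahn:
  fixes M N :: "'a measure"
  assumes sets [simp]: "sets N = sets M" and [measurable]: "Y \<in> sets M" "A \<in> sets M"
    and NM: "\<And>X. X \<in> sets M \<Longrightarrow> X \<subseteq> Y \<Longrightarrow> emeasure N X \<le> emeasure M X"
    and MN: "\<And>X. X \<in> sets M \<Longrightarrow> X \<inter> Y = {} \<Longrightarrow> emeasure M X \<le> emeasure N X"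
  shows "emeasure (sup M N) A \<le> emeasure M (A \<inter> Y) + emeasure N (A - Y)"
proof -
  \<comment> \<open>Measures are ordered lexicographically by space, sigma-algebra and values; the
    first two agree here.\<close>
  have "sup M N = sup_measure' M N"
    using sets_eq_imp_space_eq[OF sets] by (simp add: sup_measure_def sup_lexord_def)
  also have "emeasure \<dots> A = (SUP Z\<in>sets M. emeasure M (A \<inter> Z) + emeasure N (A \<inter> - Z))"
    by (rule emeasure_sup_measure') auto
  also have "\<dots> \<le> emeasure M (A \<inter> Y) + emeasure N (A - Y)"
  proof (rule SUP_least)
    fix Z assume [measurable]: "Z \<in> sets M"
    have "emeasure M (A \<inter> Z) = emeasure M (A \<inter> Z \<inter> Y) + emeasure M (A \<inter> Z - Y)"
      by (subst plus_emeasure) (auto intro!: arg_cong[where f="emeasure M"])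
    also have "emeasure M (A \<inter> Z - Y) \<le> emeasure N (A \<inter> Z - Y)"
      by (rule MN) auto
    finally have 1: "emeasure M (A \<inter> Z) \<le> emeasure M (A \<inter> Z \<inter> Y) + emeasure N (A \<inter> Z - Y)"
      by (auto simp: add_mono)
    have "A \<inter> - Z \<in> sets M"
      by (simp flip: Diff_eq)
    then have "emeasure N (A \<inter> - Z) = emeasure N ((A - Z) \<inter> Y) + emeasure N (A - Z - Y)"
      by (subst plus_emeasure) (auto intro!: arg_cong[where f="emeasure N"])
    also have "emeasure N ((A - Z) \<inter> Y) \<le> emeasure M ((A - Z) \<inter> Y)"
      by (rule NM) auto
    finally have 2: "emeasure N (A \<inter> - Z) \<le> emeasure M ((A - Z) \<inter> Y) + emeasure N (A - Z - Y)"
      by (auto simp: add_mono)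
    have "emeasure M (A \<inter> Y) = emeasure M (A \<inter> Z \<inter> Y) + emeasure M ((A - Z) \<inter> Y)"
      by (subst plus_emeasure) (auto intro!: arg_cong[where f="emeasure M"])
    moreover have "emeasure N (A - Y) = emeasure N (A \<inter> Z - Y) + emeasure N (A - Z - Y)"
      by (subst plus_emeasure) (auto intro!: arg_cong[where f="emeasure N"])
    ultimately show "emeasure M (A \<inter> Z) + emeasure N (A \<inter> - Z)
        \<le> emeasure M (A \<inter> Y) + emeasure N (A - Y)"
      using add_mono[OF 1 2] by (simp add: ac_simps)
  qed
  finally show ?thesis .
qed

text \<open>Induction on \<open>J\<close>: a Hahn set of the new measure against the supremum of the
  old ones becomes the new cell, and it is removed from every old cell.\<close>

lemma finite_SUP_measure_partition:
  fixes M :: "'i \<Rightarrow> 'a measure"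
  assumes "finite J" "J \<noteq> {}"
    and "\<And>i. i \<in> J \<Longrightarrow> finite_measure (M i)" "\<And>i. i \<in> J \<Longrightarrow> sets (M i) = sets N"
  shows "\<exists>D. disjoint_family_on D J \<and> D ` J \<subseteq> sets N \<and>
    (\<forall>A\<in>sets N. emeasure (SUP i\<in>J. M i) A \<le> (\<Sum>i\<in>J. emeasure (M i) (A \<inter> D i)))"
  using assms
proof (induction J rule: finite_ne_induct)
  case (singleton i)
  have "A \<in> sets N \<Longrightarrow> A \<inter> space N = A" for A
    using sets.sets_into_space by auto
  then show ?case
    by (intro exI[of _ "\<lambda>_. space N"]) (auto simp: disjoint_family_on_def)
next
  case (insert i J)
  let ?S = "SUP j\<in>J. M j"
  note fin = insert.prems(1) and sets = insert.prems(2)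
  obtain D where D: "disjoint_family_on D J" "D ` J \<subseteq> sets N"
    and le: "\<And>A. A \<in> sets N \<Longrightarrow> emeasure ?S A \<le> (\<Sum>j\<in>J. emeasure (M j) (A \<inter> D j))"
    using insert.IH insert.prems by (auto 4 4)
  have sets_S: "sets ?S = sets N"
    by (rule sets_SUP) (use insert in auto)
  have space_S: "space ?S = space N"
    using sets_S by (rule sets_eq_imp_space_eq)
  \<comment> \<open>The Hahn decomposition is taken between finite measures; the induction bound on
    the whole space shows that the supremum so far is finite.\<close>
  have "(\<Sum>j\<in>J. emeasure (M j) (space N \<inter> D j)) < \<infinity>"
    using insert.hyps fin by (simp add: less_top[symmetric] finite_measure.emeasure_finite)
  with le[of "space N"] have "finite_measure ?S"
    by (intro finite_measureI) (auto simp: space_S top_unique)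
  with finite_unsigned_Hahn_decomposition[of "M i" ?S] fin[of i] sets[of i] sets_S
  obtain Y where Y: "Y \<in> sets N"
    "\<And>X. X \<in> sets N \<Longrightarrow> X \<subseteq> Y \<Longrightarrow> emeasure ?S X \<le> emeasure (M i) X"
    "\<And>X. X \<in> sets N \<Longrightarrow> X \<inter> Y = {} \<Longrightarrow> emeasure (M i) X \<le> emeasure ?S X"
    by auto
  define D' where "D' j = (if j = i then Y else D j - Y)" for j
  show ?case
  proof (intro exI[of _ D'] conjI ballI)
    show "disjoint_family_on D' (insert i J)"
      using D(1) by (auto simp: disjoint_family_on_def D'_def)
    show "D' ` insert i J \<subseteq> sets N"
      using D(2) Y(1) by (auto simp: D'_def)
    fix A assume A: "A \<in> sets N"
    have "emeasure (sup (M i) ?S) A \<le> emeasure (M i) (A \<inter> Y) + emeasure ?S (A - Y)"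
      by (rule emeasure_sup_le_Hahn) (use Y A sets sets_S in auto)
    also have "emeasure ?S (A - Y) \<le> (\<Sum>j\<in>J. emeasure (M j) ((A - Y) \<inter> D j))"
      using A Y(1) by (intro le) auto
    also have "\<dots> = (\<Sum>j\<in>J. emeasure (M j) (A \<inter> D' j))"
      using insert.hyps by (intro sum.cong arg_cong2[where f=emeasure]) (auto simp: D'_def)
    finally show "emeasure (SUP j\<in>insert i J. M j) A \<le> (\<Sum>j\<in>insert i J. emeasure (M j) (A \<inter> D' j))"
      using insert.hyps by (simp add: D'_def add_mono)
  qed
qed

text \<open>The value of a supremum of measures is reached through finite subfamilies, and each of
  these is controlled by a disjoint choice of cells. This reduces a mass bound for an uncountable
  supremum to finitely many members tested on disjoint sets.\<close>

lemma emeasure_SUP_space_le: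
  fixes M :: "'i \<Rightarrow> 'a measure"
  assumes "I \<noteq> {}" and fin: "\<And>i. i \<in> I \<Longrightarrow> finite_measure (M i)"
    and sets: "\<And>i. i \<in> I \<Longrightarrow> sets (M i) = sets N"
    and le: "\<And>J D. finite J \<Longrightarrow> J \<subseteq> I \<Longrightarrow> disjoint_family_on D J \<Longrightarrow> D ` J \<subseteq> sets N \<Longrightarrow>
      (\<Sum>i\<in>J. emeasure (M i) (D i)) \<le> c"
  shows "emeasure (SUP i\<in>I. M i) (space N) \<le> c"
proof -
  have "emeasure (SUP i\<in>J. M i) (space N) \<le> c" if J: "J \<noteq> {}" "finite J" "J \<subseteq> I" for J
  proof -
    from J fin sets have "\<exists>D. disjoint_family_on D J \<and> D ` J \<subseteq> sets N \<and>
      (\<forall>A\<in>sets N. emeasure (SUP i\<in>J. M i) A \<le> (\<Sum>i\<in>J. emeasure (M i) (A \<inter> D i)))"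
      by (intro finite_SUP_measure_partition) auto
    then obtain D where D: "disjoint_family_on D J" "D ` J \<subseteq> sets N"
      "\<And>A. A \<in> sets N \<Longrightarrow> emeasure (SUP i\<in>J. M i) A \<le> (\<Sum>i\<in>J. emeasure (M i) (A \<inter> D i))"
      by auto
    have "emeasure (SUP i\<in>J. M i) (space N) \<le> (\<Sum>i\<in>J. emeasure (M i) (space N \<inter> D i))"
      by (rule D(3)) auto
    also have "\<dots> = (\<Sum>i\<in>J. emeasure (M i) (D i))"
      using D(2) sets.sets_into_space[of _ N]
      by (intro sum.cong arg_cong2[where f=emeasure]) auto
    also have "\<dots> \<le> c"
      using J D by (intro le)
    finally show ?thesis .
  qed
  then show ?thesis
    by (subst emeasure_SUP[where N=N]) (use assms in \<open>auto intro!: SUP_least\<close>)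
qed

text \<open>The supremum restricted to the complement of \<open>A\<close> is still an upper bound of
  every \<open>M i\<close>, so it dominates the supremum itself; but it vanishes on
  \<open>A\<close>. The argument does not see the size of \<open>I\<close>.\<close>

lemma null_sets_SUP_measure:
  fixes M :: "'i \<Rightarrow> 'a measure"
  assumes "I \<noteq> {}" and sets: "\<And>i. i \<in> I \<Longrightarrow> sets (M i) = sets N"
    and A: "\<And>i. i \<in> I \<Longrightarrow> A \<in> null_sets (M i)"
  shows "A \<in> null_sets (SUP i\<in>I. M i)"
proof -
  let ?S = "SUP i\<in>I. M i"
  have [simp]: "sets ?S = sets N"
    using assms by (intro sets_SUP)
  have AN [measurable]: "A \<in> sets N"
    using assms by auto
  have space: "space ?S = space N"
    by (rule sets_eq_imp_space_eq) simp
  have "?S \<le> density ?S (indicator (space N - A))"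
  proof (rule SUP_least)
    fix i assume i: "i \<in> I"
    show "M i \<le> density ?S (indicator (space N - A))"
    proof (subst le_measure, goal_cases)
      case 2
      show ?case
      proof
        fix B assume "B \<in> sets (M i)"
        then have B: "B \<in> sets N" using sets i by auto
        have "emeasure (M i) B = emeasure (M i) (B - A)"
          using A[OF i] B sets[OF i] by (intro emeasure_Diff_null_set[symmetric]) auto
        also have "\<dots> \<le> emeasure ?S (B - A)"
          using sets[OF i] by (intro le_measureD3 SUP_upper i) simp
        also have "B - A = (space N - A) \<inter> B"
          using sets.sets_into_space[OF B] by auto
        also have "emeasure ?S \<dots> = emeasure (density ?S (indicator (space N - A))) B"
          using B by (subst emeasure_restricted) auto
        finally show "emeasure (M i) B \<le> emeasure (density ?S (indicator (space N - A))) B" .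
      qed
    qed (use sets[OF i] in simp)
  qed
  then have "emeasure ?S A \<le> emeasure (density ?S (indicator (space N - A))) A"
    by (rule le_measureD3) simp
  also have "\<dots> = 0"
    using emeasure_restricted[of "space N - A" ?S A] by (simp add: Int_commute)
  finally show ?thesis
    by (intro null_setsI) auto
qed

text \<open>Otherwise there are sets of \<open>M\<close>-mass below \<open>(1/2)^k\<close> and
  \<open>N\<close>-mass at least \<open>\<epsilon>\<close>. Their limsup is \<open>M\<close>-null by
  Borel-Cantelli, while continuity from above keeps its \<open>N\<close>-mass at least
  \<open>\<epsilon>\<close>. This supplies the smallness condition on \<open>\<phi>\<close> in
  \<open>almost_invariant\<close>.\<close>

lemma absolutely_continuous_small_sets:
  assumes "finite_measure M" "finite_measure N" "absolutely_continuous M N"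
    and sets: "sets N = sets M" and "\<epsilon> > 0"
  shows "\<exists>\<eta>>0. \<forall>A\<in>sets M. measure M A < \<eta> \<longrightarrow> measure N A < \<epsilon>"
proof (rule ccontr)
  assume "\<not> ?thesis"
  then have "\<forall>k. \<exists>A\<in>sets M. measure M A < (1/2)^k \<and> \<epsilon> \<le> measure N A"
    by (metis not_le zero_less_divide_1_iff zero_less_numeral zero_less_power)
  then obtain A where A [measurable]: "\<And>k::nat. A k \<in> sets M"
    and small: "\<And>k. measure M (A k) < (1/2)^k" and big: "\<And>k. \<epsilon> \<le> measure N (A k)"
    by metis
  interpret M: finite_measure M by fact
  interpret N: finite_measure N by fact
  have "limsup A \<in> null_sets M"
  proof (rule borel_cantelli_limsup1)
    show "summable (\<lambda>n. measure M (A n))"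
      by (rule summable_comparison_test[OF _ summable_geometric[of "1/2::real"]])
        (use small less_imp_le in \<open>auto intro!: exI[of _ 0]\<close>)
  qed (auto simp: M.emeasure_eq_measure)
  with assms have null: "measure N (limsup A) = 0"
    by (auto simp: absolutely_continuous_def measure_eq_0_null_sets)
  define B where "B n = (\<Union>k\<in>{n..}. A k)" for n
  have B_sets [measurable]: "B n \<in> sets N" for n
    unfolding B_def sets by measurable
  have "(\<lambda>n. measure N (B n)) \<longlonglongrightarrow> measure N (\<Inter>n. B n)"
    using B_sets by (intro N.finite_Lim_measure_decseq) (auto simp: decseq_def B_def intro: order_trans)
  moreover have "(\<Inter>n. B n) = limsup A"
    by (simp add: limsup_INF_SUP B_def)
  moreover have "\<epsilon> \<le> measure N (B n)" for n
    using big[of n] by (rule order_trans) (intro N.finite_measure_mono B_sets, auto simp: B_def)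
  ultimately have "\<epsilon> \<le> measure N (limsup A)"
    by (metis LIMSEQ_le_const)
  with null \<open>\<epsilon> > 0\<close> show False by simp
qed

text \<open>Urysohn functions equal to 1 on \<open>C j\<close> and 0 on the other sets are divided
  by the maximum of 1 and their sum. On each \<open>C j\<close> this divisor is 1, so the value 1
  survives.\<close>

lemma disjoint_closed_partition_of_unity:
  fixes C :: "'i \<Rightarrow> 'a::metric_space set"
  assumes "finite J" "disjoint_family_on C J" "\<And>j. j \<in> J \<Longrightarrow> closed (C j)"
  shows "\<exists>f. (\<forall>j\<in>J. continuous_on UNIV (f j) \<and> (\<forall>x. 0 \<le> f j x) \<and> (\<forall>x\<in>C j. f j x = (1::real))) \<and>
    (\<forall>x. (\<Sum>j\<in>J. f j x) \<le> 1)"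
proof -
  have "\<forall>j\<in>J. \<exists>u. continuous_on UNIV u \<and> (\<forall>x. 0 \<le> u x) \<and> (\<forall>x\<in>C j. u x = (1::real)) \<and>
      (\<forall>i\<in>J - {j}. \<forall>x\<in>C i. u x = 0)"
  proof
    fix j assume j: "j \<in> J"
    have "normal_space (euclidean :: 'a topology)"
      by (simp add: metrizable_imp_normal_space metrizable_space_euclidean)
    moreover have "closed (\<Union>i\<in>J - {j}. C i)"
      using assms by auto
    moreover have "disjnt (\<Union>i\<in>J - {j}. C i) (C j)"
      using assms(2) j by (auto simp: disjoint_family_on_def disjnt_def)
    ultimately obtain u where "continuous_map euclidean (top_of_set {0..1::real}) u"
      "u ` (\<Union>i\<in>J - {j}. C i) \<subseteq> {0}" "u ` C j \<subseteq> {1}"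
      using Urysohn_lemma[of euclidean "\<Union>i\<in>J - {j}. C i" "C j" 0 1] assms(3)[OF j] by auto
    then show "\<exists>u. continuous_on UNIV u \<and> (\<forall>x. 0 \<le> u x) \<and> (\<forall>x\<in>C j. u x = (1::real)) \<and>
        (\<forall>i\<in>J - {j}. \<forall>x\<in>C i. u x = 0)"
      by (intro exI[of _ u]) (auto simp: continuous_map_in_subtopology image_subset_iff)
  qed
  from bchoice[OF this] obtain u where "\<forall>j\<in>J. continuous_on UNIV (u j) \<and> (\<forall>x. 0 \<le> u j x) \<and> (\<forall>x\<in>C j. u j x = (1::real)) \<and>
      (\<forall>i\<in>J - {j}. \<forall>x\<in>C i. u j x = 0)"
    by (elim exE)
  then have u: "\<And>j. j \<in> J \<Longrightarrow> continuous_on UNIV (u j)" "\<And>j x. j \<in> J \<Longrightarrow> 0 \<le> u j x"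
    "\<And>j x. j \<in> J \<Longrightarrow> x \<in> C j \<Longrightarrow> u j x = (1::real)"
    "\<And>i j x. j \<in> J \<Longrightarrow> i \<in> J \<Longrightarrow> i \<noteq> j \<Longrightarrow> x \<in> C i \<Longrightarrow> u j x = 0"
    by auto
  define s where "s x = max 1 (\<Sum>j\<in>J. u j x)" for x
  have s: "s x \<ge> 1" "(\<Sum>j\<in>J. u j x) \<le> s x" for x
    by (auto simp: s_def)
  have cont: "continuous_on UNIV s"
    unfolding s_def using u(1) by (intro continuous_intros) auto
  have "s x = 1" if "j \<in> J" "x \<in> C j" for j x
  proof -
    have "(\<Sum>i\<in>J. u i x) = (\<Sum>i\<in>J. if i = j then 1 else 0)"
      using that u by (intro sum.cong) auto
    then show ?thesis
      using that assms(1) by (simp add: s_def)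
  qed
  moreover have "s x \<noteq> 0" "0 < s x" for x
    using s(1)[of x] by auto
  ultimately show ?thesis
    using u cont s
    by (intro exI[of _ "\<lambda>j x. u j x / s x"])
      (auto intro!: continuous_on_divide divide_nonneg_pos simp flip: sum_divide_distrib)
qed

section \<open>Evolution of measures under a transition function\<close>

locale markov_transition =
  fixes P :: "real \<Rightarrow> 'a::polish_space \<Rightarrow> 'a measure"
  assumes markov: "markov_tf P"
begin

text \<open>
  Negative times are mapped to \<open>0\<close>, so that \<open>Q\<close> is a jointly measurable kernel on the whole line;
  \<open>Q 0\<close> need not be the identity kernel.
\<close>

definition Q :: "real \<Rightarrow> 'a \<Rightarrow> 'a measure" where
  "Q s = P (max 0 s)"

lemma Q_eq: "0 \<le> s \<Longrightarrow> Q s = P s"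
  by (simp add: Q_def)

lemma sets_Q [simp, measurable_cong]: "sets (Q s x) = sets borel"
  and prob_space_Q: "prob_space (Q s x)"
  using markov by (auto simp: Q_def markov_tf_def)

lemma space_Q [simp]: "space (Q s x) = UNIV"
  by (simp add: sets_eq_imp_space_eq[OF sets_Q])

lemma emeasure_Q_UNIV [simp]: "emeasure (Q s x) UNIV = 1"
  using prob_space.emeasure_space_1[OF prob_space_Q, of s x] by simp

lemma measurable_Q_prob [measurable (raw)]:
  assumes [measurable]: "f \<in> borel_measurable N" "g \<in> borel_measurable N"
  shows "(\<lambda>w. Q (f w) (g w)) \<in> N \<rightarrow>\<^sub>M prob_algebra borel"
proof (intro measurable_prob_algebraI measurable_subprob_algebra)
  fix A :: "'a set" assume A: "A \<in> sets borel"
  let ?R = "restrict_space borel ({0..} \<times> UNIV) :: (real \<times> 'a) measure"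
  \<comment> \<open>Clamping lands in the half line of times on which joint measurability is
    assumed.\<close>
  have "(\<lambda>w. (max 0 (f w), g w)) \<in> N \<rightarrow>\<^sub>M ?R"
    by (intro measurable_restrict_space2) (auto simp flip: borel_prod)
  moreover have "(\<lambda>z. emeasure (P (fst z) (snd z)) A) \<in> borel_measurable ?R"
    using markov A by (auto simp: markov_tf_def)
  ultimately have "(\<lambda>w. emeasure (P (fst (max 0 (f w), g w)) (snd (max 0 (f w), g w))) A) \<in> borel_measurable N"
    by (rule measurable_compose)
  then show "(\<lambda>w. emeasure (Q (f w) (g w)) A) \<in> borel_measurable N"
    by (simp add: Q_def)
qed (auto intro: prob_space_Q prob_space_imp_subprob_space)

lemma measurable_Q [measurable (raw)]:
  "f \<in> borel_measurable N \<Longrightarrow> g \<in> borel_measurable N \<Longrightarrow>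
    (\<lambda>w. Q (f w) (g w)) \<in> N \<rightarrow>\<^sub>M subprob_algebra borel"
  by (intro measurable_prob_algebraD measurable_Q_prob)

lemma measurable_Q_const [measurable]: "Q s \<in> borel \<rightarrow>\<^sub>M subprob_algebra borel"
  by (rule measurable_Q[of "\<lambda>_. s" borel "\<lambda>x. x"]) auto

text \<open>Chapman-Kolmogorov as a composition of kernels. The sign conditions matter because
  clamping at 0 does not respect sums of times of opposite sign.\<close>

lemma Q_bind_Q: "0 \<le> s \<Longrightarrow> 0 \<le> t \<Longrightarrow> Q s x \<bind> Q t = Q (s + t) x"
proof (rule measure_eqI)
  show sets: "sets (Q s x \<bind> Q t) = sets (Q (s + t) x)"
    by (subst sets_bind[where N=borel]) auto
  fix A assume "0 \<le> s" "0 \<le> t" and "A \<in> sets (Q s x \<bind> Q t)"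
  then have A: "A \<in> sets borel"
    unfolding sets by simp
  then show "emeasure (Q s x \<bind> Q t) A = emeasure (Q (s + t) x) A"
  proof -
    have "emeasure (Q s x \<bind> Q t) A = (\<integral>\<^sup>+y. emeasure (Q t y) A \<partial>Q s x)"
      using A by (intro emeasure_bind) auto
    then show ?thesis
      using markov A \<open>0 \<le> s\<close> \<open>0 \<le> t\<close> by (simp add: markov_tf_def Q_eq)
  qed
qed

text \<open>The action of the transition function on measures, written \<open>m P\<^sub>t\<close> in
  the overview.\<close>

definition evolve :: "'a measure \<Rightarrow> real \<Rightarrow> 'a measure" where
  "evolve N t = N \<bind> Q t"

context
  fixes N :: "'a measure"
  assumes sets_N [measurable_cong]: "sets N = sets borel"
begin

lemma space_N: "space N = UNIV"
  using sets_eq_imp_space_eq[OF sets_N] by simp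

lemma sets_evolve: "sets (evolve N t) = sets borel"
  unfolding evolve_def by (subst sets_bind[where N=borel]) (auto simp: space_N)

lemma space_evolve: "space (evolve N t) = UNIV"
  using sets_eq_imp_space_eq[OF sets_evolve] by simp

lemma nn_integral_evolve:
  "f \<in> borel_measurable borel \<Longrightarrow> (\<integral>\<^sup>+x. f x \<partial>evolve N t) = (\<integral>\<^sup>+x. (\<integral>\<^sup>+y. f y \<partial>Q t x) \<partial>N)"
  unfolding evolve_def by (intro nn_integral_bind) auto

lemma emeasure_evolve:
  "A \<in> sets borel \<Longrightarrow> emeasure (evolve N t) A = (\<integral>\<^sup>+x. emeasure (Q t x) A \<partial>N)"
  unfolding evolve_def by (intro emeasure_bind) (auto simp: space_N)

lemma emeasure_evolve_UNIV: "emeasure (evolve N t) UNIV = emeasure N UNIV"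
  by (simp add: emeasure_evolve space_N)

lemma finite_measure_evolve: "finite_measure N \<Longrightarrow> finite_measure (evolve N t)"
  using emeasure_evolve_UNIV finite_measure.emeasure_finite
  by (intro finite_measureI) (auto simp: space_evolve)

lemma evolve_evolve: "0 \<le> s \<Longrightarrow> 0 \<le> t \<Longrightarrow> evolve (evolve N s) t = evolve N (s + t)"
  unfolding evolve_def by (subst bind_assoc[where N=borel and R=borel]) (auto simp: Q_bind_Q)

end

lemma evolve_mono:
  assumes "M \<le> N" and M: "sets M = sets borel" and N: "sets N = sets borel"
  shows "evolve M t \<le> evolve N t"
  using assms by (subst le_measure)
    (auto simp: sets_evolve emeasure_evolve intro!: nn_integral_mono_measure)

text \<open>The time average of the laws \<open>\<nu> P\<^sub>s\<close> as a mixture over a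
  uniformly distributed time. The open interval is the one underlying the interval integral in
  \<open>time_avg\<close>.\<close>

definition occupation :: "'a measure \<Rightarrow> real \<Rightarrow> 'a measure" where
  "occupation \<nu> T = uniform_measure lborel {0<..<T} \<bind> evolve \<nu>"

context
  fixes \<nu> :: "'a measure"
  assumes prob_nu: "prob_space \<nu>" and sets_nu [measurable_cong]: "sets \<nu> = sets borel"
begin

interpretation nu: prob_space \<nu> by (rule prob_nu)

lemma measurable_evolve [measurable]: "evolve \<nu> \<in> borel \<rightarrow>\<^sub>M subprob_algebra borel"
proof -
  have "\<nu> \<in> space (subprob_algebra borel)"
    using prob_nu sets_nu by (simp add: space_subprob_algebra prob_space_imp_subprob_space)
  then show ?thesis
    unfolding evolve_def by (intro measurable_bind[where N=borel]) auto
qed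

lemma prob_space_evolve: "prob_space (evolve \<nu> s)"
  using emeasure_evolve_UNIV[OF sets_nu] nu.emeasure_space_1 space_N[OF sets_nu]
  by (intro prob_spaceI) (simp add: space_evolve[OF sets_nu])

lemma sets_occupation: "sets (occupation \<nu> T) = sets borel"
  unfolding occupation_def by (subst sets_bind[where N=borel]) (auto simp: sets_evolve[OF sets_nu])

lemma space_occupation: "space (occupation \<nu> T) = UNIV"
  using sets_eq_imp_space_eq[OF sets_occupation] by simp

lemma nn_integral_occupation:
  assumes "T > 0" and [measurable]: "f \<in> borel_measurable borel"
  shows "(\<integral>\<^sup>+x. f x \<partial>occupation \<nu> T) =
    (\<integral>\<^sup>+s. (\<integral>\<^sup>+x. f x \<partial>evolve \<nu> s) * indicator {0<..<T} s \<partial>lborel) / ennreal T"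
proof -
  have "(\<integral>\<^sup>+x. f x \<partial>occupation \<nu> T) = (\<integral>\<^sup>+s. (\<integral>\<^sup>+x. f x \<partial>evolve \<nu> s) \<partial>uniform_measure lborel {0<..<T})"
    unfolding occupation_def by (intro nn_integral_bind[where B=borel]) auto
  also have "\<dots> = (\<integral>\<^sup>+s. (\<integral>\<^sup>+x. f x \<partial>evolve \<nu> s) * indicator {0<..<T} s \<partial>lborel) / emeasure lborel {0<..<T}"
    by (intro nn_integral_uniform_measure) auto
  finally show ?thesis using assms by simp
qed

lemma prob_space_occupation:
  assumes "T > 0" shows "prob_space (occupation \<nu> T)"
  unfolding occupation_def
proof (rule prob_space.prob_space_bind[where S=borel])
  show "prob_space (uniform_measure lborel {0<..<T})"
    using assms by (intro prob_space_uniform_measure) auto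
qed (auto intro: prob_space_evolve)

lemma measure_occupation:
  assumes "T > 0" and A: "A \<in> sets borel"
  shows "measure (occupation \<nu> T) A = time_avg P \<nu> T A"
proof -
  have nuP: "nuP P \<nu> s A = measure (evolve \<nu> s) A" if "s \<ge> 0" for s
  proof -
    have "measure (\<nu> \<bind> Q s) A = (\<integral>x. measure (Q s x) A \<partial>\<nu>)"
      using A by (intro nu.measure_bind[where N=borel]) auto
    with that show ?thesis
      by (simp add: nuP_def evolve_def Q_eq)
  qed
  have le_1: "measure (evolve \<nu> s) A \<le> 1" for s
    using prob_space.prob_le_1[OF prob_space_evolve] .
  have "emeasure (occupation \<nu> T) A = (\<integral>\<^sup>+s. emeasure (evolve \<nu> s) A * indicator {0<..<T} s \<partial>lborel) / ennreal T"
    using nn_integral_occupation[OF assms(1), of "indicator A"] A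
    by (simp add: sets_occupation sets_evolve[OF sets_nu])
  also have "(\<integral>\<^sup>+s. emeasure (evolve \<nu> s) A * indicator {0<..<T} s \<partial>lborel) =
      (\<integral>\<^sup>+s. ennreal (indicator {0<..<T} s * measure (evolve \<nu> s) A) \<partial>lborel)"
    using finite_measure.emeasure_eq_measure[OF prob_space.finite_measure[OF prob_space_evolve]]
    by (intro nn_integral_cong) (auto split: split_indicator)
  finally have "measure (occupation \<nu> T) A =
      enn2real (\<integral>\<^sup>+s. ennreal (indicator {0<..<T} s * measure (evolve \<nu> s) A) \<partial>lborel) / T"
    using assms by (simp add: measure_def divide_ennreal_def enn2real_mult inverse_ennreal divide_inverse)
  also have "enn2real (\<integral>\<^sup>+s. ennreal (indicator {0<..<T} s * measure (evolve \<nu> s) A) \<partial>lborel) =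
      (\<integral>s. indicator {0<..<T} s * measure (evolve \<nu> s) A \<partial>lborel)"
    using A by (intro integral_eq_nn_integral[symmetric]) (auto split: split_indicator)
  also have "\<dots> = (LBINT s=0..T. nuP P \<nu> s A)"
    using assms nuP
    by (auto simp: interval_lebesgue_integral_def set_lebesgue_integral_def zero_ereal_def
      intro!: Bochner_Integration.integral_cong split: split_indicator)
  finally show ?thesis
    by (simp add: time_avg_def)
qed

text \<open>\<open>muK\<close> is specified only by a set function. Recognising that function as the
  values of a restricted occupation measure shows that it is countably additive.\<close>

lemma muK_eq_density_occupation:
  assumes "T > 0" and K: "K \<in> sets borel"
  shows "muK P \<nu> K T = density (occupation \<nu> T) (indicator K)"
proof -
  interpret occ: prob_space "occupation \<nu> T"
    by (rule prob_space_occupation) fact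
  let ?D = "density (occupation \<nu> T) (indicator K)"
  have [simp]: "sets ?D = sets borel"
    by (simp add: sets_occupation)
  have "space ?D = UNIV"
    by (simp add: space_occupation)
  then have "?D = measure_of UNIV (sets borel) (emeasure ?D)"
    using measure_of_of_measure[of ?D] by (simp add: sets_occupation)
  also have "\<dots> = muK P \<nu> K T"
    unfolding muK_def
  proof (rule measure_of_eq)
    fix A assume "A \<in> sigma_sets UNIV (sets (borel :: 'a measure))"
    then have "A \<in> sets borel"
      using sets.sigma_sets_eq[of "borel :: 'a measure"] by simp
    then show "emeasure ?D A = ennreal (time_avg P \<nu> T (K \<inter> A))"
      using K assms measure_occupation[of T "K \<inter> A"]
      by (subst emeasure_restricted) (auto simp: sets_occupation occ.emeasure_eq_measure)
  qed simp
  finally show ?thesis ..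
qed

text \<open>Evolving by \<open>t\<close> moves the time window from \<open>(0, T)\<close> to
  \<open>(t, T + t)\<close>. The times gained have total length \<open>t\<close> and contribute at
  most 1 each, before division by \<open>T\<close>.\<close>

lemma nn_integral_occupation_shift:
  assumes "T > 0" "t \<ge> 0" and f [measurable]: "f \<in> borel_measurable borel" and le_1: "\<And>x. f x \<le> 1"
  shows "(\<integral>\<^sup>+x. (\<integral>\<^sup>+y. f y \<partial>Q t x) \<partial>occupation \<nu> T) \<le> (\<integral>\<^sup>+x. f x \<partial>occupation \<nu> T) + ennreal (t / T)"
proof -
  define \<phi> where "\<phi> s = (\<integral>\<^sup>+x. f x \<partial>evolve \<nu> s)" for s
  have [measurable]: "\<phi> \<in> borel_measurable borel"
    unfolding \<phi>_def by measurable
  have \<phi>_le: "\<phi> s \<le> 1" for s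
  proof -
    have "\<phi> s \<le> (\<integral>\<^sup>+x. 1 \<partial>evolve \<nu> s)"
      unfolding \<phi>_def by (intro nn_integral_mono le_1)
    then show ?thesis
      using prob_space.emeasure_space_1[OF prob_space_evolve[of s]] by simp
  qed
  have [measurable]: "(\<lambda>x. \<integral>\<^sup>+y. f y \<partial>Q t x) \<in> borel_measurable borel"
    by measurable
  have "(\<integral>\<^sup>+s. (\<integral>\<^sup>+x. (\<integral>\<^sup>+y. f y \<partial>Q t x) \<partial>evolve \<nu> s) * indicator {0<..<T} s \<partial>lborel)
      = (\<integral>\<^sup>+s. \<phi> (s + t) * indicator {0<..<T} s \<partial>lborel)"
  proof (intro nn_integral_cong)
    fix s :: real
    show "(\<integral>\<^sup>+x. (\<integral>\<^sup>+y. f y \<partial>Q t x) \<partial>evolve \<nu> s) * indicator {0<..<T} s = \<phi> (s + t) * indicator {0<..<T} s"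
    proof (cases "0 < s")
      case True
      then have "(\<integral>\<^sup>+x. (\<integral>\<^sup>+y. f y \<partial>Q t x) \<partial>evolve \<nu> s) = \<phi> (s + t)"
        unfolding \<phi>_def using \<open>t \<ge> 0\<close>
        by (subst evolve_evolve[OF sets_nu, symmetric]) (auto simp: nn_integral_evolve sets_evolve sets_nu)
      then show ?thesis by simp
    qed simp
  qed
  also have "\<dots> = (\<integral>\<^sup>+u. \<phi> u * indicator {t<..<T + t} u \<partial>lborel)"
  proof -
    have "indicator {t<..<T + t} (t + s) = (indicator {0<..<T} s :: ennreal)" for s
      by (simp split: split_indicator)
    then show ?thesis
      using nn_integral_real_affine[of "\<lambda>u. \<phi> u * indicator {t<..<T + t} u" 1 t]
      by (simp add: add.commute[of t])
  qed
  \<comment> \<open>The added interval is closed at \<open>T\<close>, since the open window leaves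
    that point uncovered.\<close>
  also have "\<dots> \<le> (\<integral>\<^sup>+u. \<phi> u * indicator {0<..<T} u + indicator {T..T + t} u \<partial>lborel)"
  proof (intro nn_integral_mono)
    fix u show "\<phi> u * indicator {t<..<T + t} u \<le> \<phi> u * indicator {0<..<T} u + indicator {T..T + t} u"
      using \<open>t \<ge> 0\<close> \<phi>_le[of u] by (simp split: split_indicator)
  qed
  also have "\<dots> = (\<integral>\<^sup>+u. \<phi> u * indicator {0<..<T} u \<partial>lborel) + ennreal t"
    using \<open>t \<ge> 0\<close> by (subst nn_integral_add) simp_all
  finally have "(\<integral>\<^sup>+x. (\<integral>\<^sup>+y. f y \<partial>Q t x) \<partial>occupation \<nu> T) \<le>
      ((\<integral>\<^sup>+u. \<phi> u * indicator {0<..<T} u \<partial>lborel) + ennreal t) / ennreal T"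
    using assms by (simp add: nn_integral_occupation divide_right_mono_ennreal)
  also have "\<dots> = (\<integral>\<^sup>+x. f x \<partial>occupation \<nu> T) + ennreal t / ennreal T"
    using assms by (simp add: nn_integral_occupation \<phi>_def add_divide_distrib_ennreal)
  also have "ennreal t / ennreal T = ennreal (t / T)"
    using assms by (simp add: divide_ennreal)
  finally show ?thesis .
qed

end

end

section \<open>Weak limits of restricted occupation measures\<close>

locale occupation_limit = markov_transition P
  for P :: "real \<Rightarrow> 'a::polish_space \<Rightarrow> 'a measure" +
  fixes \<nu> \<mu> :: "'a measure" and K :: "'a set" and T :: "nat \<Rightarrow> real"
  assumes feller: "feller P"
    and prob_nu: "prob_space \<nu>" and sets_nu: "sets \<nu> = sets borel"
    and K: "K \<in> sets borel"
    and T_pos: "\<And>k. T k > 0" and T_at_top: "filterlim T at_top sequentially"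
    and finite_mu: "finite_measure \<mu>" and sets_mu [measurable_cong]: "sets \<mu> = sets borel"
    and weak_conv: "weak_conv_meas (\<lambda>k. muK P \<nu> K (T k)) \<mu>"
begin

text \<open>Before the limit, the restriction to \<open>K\<close> is dropped, each
  \<open>P\<^sub>\<tau>\<close> is absorbed by the occupation measure at cost
  \<open>\<tau> j / T k\<close>, and the remaining integrand is at most 1. The Feller property
  allows the passage to the weak limit, where the cost vanishes.\<close>

lemma sum_nn_integral_evolve_continuous_le:
  fixes f :: "'i \<Rightarrow> 'a \<Rightarrow> real"
  assumes J: "finite J" and f: "\<And>j. j \<in> J \<Longrightarrow> continuous_on UNIV (f j)" "\<And>j x. j \<in> J \<Longrightarrow> 0 \<le> f j x"
    and sum_le: "\<And>x. (\<Sum>j\<in>J. f j x) \<le> 1"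
    and \<tau>: "\<And>j. j \<in> J \<Longrightarrow> 0 \<le> \<tau> j"
  shows "(\<Sum>j\<in>J. \<integral>\<^sup>+x. ennreal (f j x) \<partial>evolve \<mu> (\<tau> j)) \<le> 1"
proof -
  interpret mu: finite_measure \<mu> by (rule finite_mu)
  have f_le: "f j x \<le> 1" if "j \<in> J" for j x
    using member_le_sum[of j J "\<lambda>j. f j x"] that f(2) J sum_le[of x] by auto
  have f_meas: "f j \<in> borel_measurable borel" if "j \<in> J" for j
    using f(1)[OF that] by (rule borel_measurable_continuous_onI)
  define g where "g j x = (\<integral>y. f j y \<partial>Q (\<tau> j) x)" for j x
  have f_int: "integrable (Q s x) (f j)" if "j \<in> J" for j s x
    using f_le[OF that] f(2)[OF that] f_meas[OF that]
    by (intro finite_measure.integrable_const_bound[OF prob_space.finite_measure[OF prob_space_Q], where B=1])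
      auto
  have g_eq: "ennreal (g j x) = (\<integral>\<^sup>+y. ennreal (f j y) \<partial>Q (\<tau> j) x)" if "j \<in> J" for j x
    unfolding g_def using f_int[OF that] f(2)[OF that] by (intro nn_integral_eq_integral[symmetric]) auto
  have g_nonneg: "0 \<le> g j x" if "j \<in> J" for j x
    unfolding g_def using f(2)[OF that] by (intro integral_nonneg_AE) auto
  have g_le: "g j x \<le> 1" if "j \<in> J" for j x
    unfolding g_def using f_le[OF that] f_int[OF that]
    by (intro prob_space.integral_le_const[OF prob_space_Q]) auto
  have g_bdd: "bounded (range (g j))" if "j \<in> J" for j
    using g_nonneg[OF that] g_le[OF that] by (intro boundedI[of _ 1]) auto
  \<comment> \<open>Here the Feller property enters: it makes \<open>g j\<close> a test function for
    weak convergence.\<close>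
  have g_cont: "continuous_on UNIV (g j)" if "j \<in> J" for j
  proof -
    have "bounded (range (f j))"
      using f(2)[OF that] f_le[OF that] by (intro boundedI[of _ 1]) auto
    with f(1)[OF that] \<tau>[OF that] feller show ?thesis
      unfolding feller_def g_def Q_eq[OF \<tau>[OF that]] by auto
  qed
  have g_meas [measurable]: "g j \<in> borel_measurable borel" if "j \<in> J" for j
    using g_cont[OF that] by (rule borel_measurable_continuous_onI)

  let ?O = "\<lambda>k. occupation \<nu> (T k)"
  let ?M = "\<lambda>k. muK P \<nu> K (T k)"
  have "(\<Sum>j\<in>J. \<integral>x. g j x \<partial>?M k) \<le> 1 + (\<Sum>j\<in>J. \<tau> j) / T k" for k
  proof -
    interpret occ: prob_space "?O k"
      by (rule prob_space_occupation[OF prob_nu sets_nu T_pos])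
    have M_eq: "?M k = density (?O k) (indicator K)"
      by (rule muK_eq_density_occupation[OF prob_nu sets_nu T_pos K])
    have sets_O [measurable_cong]: "sets (?O k) = sets borel"
      by (rule sets_occupation[OF prob_nu sets_nu])
    have g_M_le: "ennreal (\<integral>x. g j x \<partial>?M k) \<le> (\<integral>\<^sup>+x. ennreal (f j x) \<partial>?O k) + ennreal (\<tau> j / T k)"
      if j: "j \<in> J" for j
    proof -
      have "(\<integral>\<^sup>+x. ennreal (g j x) \<partial>?M k) = (\<integral>\<^sup>+x. indicator K x * ennreal (g j x) \<partial>?O k)"
        unfolding M_eq using K g_meas[OF j] by (intro nn_integral_density) auto
      also have "\<dots> \<le> (\<integral>\<^sup>+x. ennreal (g j x) \<partial>?O k)"
        by (intro nn_integral_mono) (auto split: split_indicator)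
      also have "\<dots> = (\<integral>\<^sup>+x. (\<integral>\<^sup>+y. ennreal (f j y) \<partial>Q (\<tau> j) x) \<partial>?O k)"
        using j by (simp add: g_eq)
      also have "\<dots> \<le> (\<integral>\<^sup>+x. ennreal (f j x) \<partial>?O k) + ennreal (\<tau> j / T k)"
        using f_le[OF j] f_meas[OF j] \<tau>[OF j] T_pos
        by (intro nn_integral_occupation_shift[OF prob_nu sets_nu]) auto
      finally have le: "(\<integral>\<^sup>+x. ennreal (g j x) \<partial>?M k) \<le> (\<integral>\<^sup>+x. ennreal (f j x) \<partial>?O k) + ennreal (\<tau> j / T k)" .
      have "(\<integral>x. g j x \<partial>?M k) = enn2real (\<integral>\<^sup>+x. ennreal (g j x) \<partial>?M k)"
        using g_nonneg[OF j] g_meas[OF j] by (intro integral_eq_nn_integral) (auto simp: M_eq)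
      \<comment> \<open>Going through \<open>enn2real\<close>, which sends infinity to 0, gives this
        inequality without an integrability argument.\<close>
      then have "ennreal (\<integral>x. g j x \<partial>?M k) \<le> (\<integral>\<^sup>+x. ennreal (g j x) \<partial>?M k)"
        by (metis enn2real_positive_iff ennreal_enn2real_if zero_le order_refl)
      with le show ?thesis by (rule order_trans[rotated])
    qed
    have "ennreal (\<Sum>j\<in>J. \<integral>x. g j x \<partial>?M k) = (\<Sum>j\<in>J. ennreal (\<integral>x. g j x \<partial>?M k))"
      using g_nonneg by (intro sum_ennreal[symmetric] integral_nonneg_AE) auto
    also have "\<dots> \<le> (\<Sum>j\<in>J. (\<integral>\<^sup>+x. ennreal (f j x) \<partial>?O k) + ennreal (\<tau> j / T k))"
      by (intro sum_mono g_M_le)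
    also have "\<dots> = (\<integral>\<^sup>+x. (\<Sum>j\<in>J. ennreal (f j x)) \<partial>?O k) + (\<Sum>j\<in>J. ennreal (\<tau> j / T k))"
      using f_meas by (subst nn_integral_sum) (auto simp: sum.distrib)
    also have "(\<Sum>j\<in>J. ennreal (\<tau> j / T k)) = ennreal ((\<Sum>j\<in>J. \<tau> j) / T k)"
      using \<tau> T_pos[of k] by (subst sum_ennreal) (auto simp: sum_divide_distrib)
    also have "(\<integral>\<^sup>+x. (\<Sum>j\<in>J. ennreal (f j x)) \<partial>?O k) \<le> (\<integral>\<^sup>+x. 1 \<partial>?O k)"
      using f(2) sum_le by (intro nn_integral_mono) (simp add: sum_ennreal)
    also have "\<dots> = ennreal 1"
      by (simp add: occ.emeasure_space_1)
    finally have "ennreal (\<Sum>j\<in>J. \<integral>x. g j x \<partial>?M k) \<le> ennreal (1 + (\<Sum>j\<in>J. \<tau> j) / T k)"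
      using \<tau> T_pos[of k] by (simp add: add_mono ennreal_plus sum_nonneg)
    then show ?thesis
      using \<tau> T_pos[of k] by (subst (asm) ennreal_le_iff) (auto intro!: add_nonneg_nonneg divide_nonneg_pos sum_nonneg)
  qed
  moreover have "(\<lambda>k. \<Sum>j\<in>J. \<integral>x. g j x \<partial>?M k) \<longlonglongrightarrow> (\<Sum>j\<in>J. \<integral>x. g j x \<partial>\<mu>)"
    using weak_conv g_cont g_bdd by (intro tendsto_sum) (auto simp: weak_conv_meas_def)
  moreover have "(\<lambda>k. 1 + (\<Sum>j\<in>J. \<tau> j) / T k) \<longlonglongrightarrow> 1 + 0"
    by (intro tendsto_add tendsto_const real_tendsto_divide_at_top[OF tendsto_const T_at_top])
  ultimately have le_1: "(\<Sum>j\<in>J. \<integral>x. g j x \<partial>\<mu>) \<le> 1 + 0"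
    by (intro LIMSEQ_le[of _ _ "\<lambda>k. 1 + (\<Sum>j\<in>J. \<tau> j) / T k"]) auto

  have "(\<integral>\<^sup>+x. ennreal (f j x) \<partial>evolve \<mu> (\<tau> j)) = ennreal (\<integral>x. g j x \<partial>\<mu>)" if j: "j \<in> J" for j
  proof -
    have "(\<integral>\<^sup>+x. ennreal (f j x) \<partial>evolve \<mu> (\<tau> j)) = (\<integral>\<^sup>+x. ennreal (g j x) \<partial>\<mu>)"
      using f_meas[OF j] j by (simp add: nn_integral_evolve[OF sets_mu] g_eq)
    also have "\<dots> = ennreal (\<integral>x. g j x \<partial>\<mu>)"
      using g_nonneg[OF j] g_le[OF j] g_meas[OF j]
      by (intro nn_integral_eq_integral mu.integrable_const_bound[where B=1]) auto
    finally show ?thesis .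
  qed
  then have "(\<Sum>j\<in>J. \<integral>\<^sup>+x. ennreal (f j x) \<partial>evolve \<mu> (\<tau> j)) = ennreal (\<Sum>j\<in>J. \<integral>x. g j x \<partial>\<mu>)"
    using g_nonneg by (subst sum_ennreal[symmetric]) (auto intro: integral_nonneg_AE)
  with le_1 show ?thesis
    by (simp add: ennreal_le_1)
qed

text \<open>Inner regularity replaces each \<open>A j\<close> by a compact subset. Disjoint compact
  sets carry a continuous subpartition of unity, to which the bound for continuous functions
  applies.\<close>

lemma sum_emeasure_evolve_disjoint_le:
  assumes J: "finite J" "disjoint_family_on A J" "\<And>j. j \<in> J \<Longrightarrow> A j \<in> sets borel"
    and \<tau>: "\<And>j. j \<in> J \<Longrightarrow> 0 \<le> \<tau> j"
  shows "(\<Sum>j\<in>J. emeasure (evolve \<mu> (\<tau> j)) (A j)) \<le> 1"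
proof (rule ennreal_le_epsilon)
  fix e :: real assume "e > 0"
  \<comment> \<open>The error \<open>e\<close> is shared among the indices; the summand 1 covers
    empty \<open>J\<close>.\<close>
  define d where "d = e / (1 + real (card J))"
  have d: "d > 0" "real (card J) * d \<le> e"
    using \<open>e > 0\<close> by (auto simp: d_def field_simps)
  have "\<forall>j\<in>J. \<exists>C. C \<subseteq> A j \<and> compact C \<and>
      emeasure (evolve \<mu> (\<tau> j)) (A j) \<le> emeasure (evolve \<mu> (\<tau> j)) C + ennreal d"
  proof
    fix j assume j: "j \<in> J"
    let ?M = "evolve \<mu> (\<tau> j)"
    interpret M: finite_measure ?M
      by (rule finite_measure_evolve[OF sets_mu finite_mu])
    have sup: "emeasure ?M (A j) = (SUP C\<in>{C. C \<subseteq> A j \<and> compact C}. emeasure ?M C)"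
      using J(3)[OF j] by (intro inner_regular sets_evolve[OF sets_mu]) auto
    \<comment> \<open>Strictness, which rests on finite mass, lets a single compact set come within
      \<open>d\<close> of the supremum.\<close>
    have "emeasure ?M (A j) < emeasure ?M (A j) + ennreal d"
      using d by (simp add: M.emeasure_eq_measure ennreal_less_iff flip: ennreal_plus)
    also have "\<dots> = (SUP C\<in>{C. C \<subseteq> A j \<and> compact C}. emeasure ?M C + ennreal d)"
      unfolding sup by (intro ennreal_SUP_add_left[symmetric]) auto
    finally have "\<exists>C\<in>{C. C \<subseteq> A j \<and> compact C}. emeasure ?M (A j) < emeasure ?M C + ennreal d"
      by (simp add: less_SUP_iff)
    then show "\<exists>C. C \<subseteq> A j \<and> compact C \<and> emeasure ?M (A j) \<le> emeasure ?M C + ennreal d"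
      by (auto intro: less_imp_le)
  qed
  from bchoice[OF this] obtain C where C: "\<And>j. j \<in> J \<Longrightarrow> C j \<subseteq> A j" "\<And>j. j \<in> J \<Longrightarrow> compact (C j)"
    "\<And>j. j \<in> J \<Longrightarrow> emeasure (evolve \<mu> (\<tau> j)) (A j) \<le> emeasure (evolve \<mu> (\<tau> j)) (C j) + ennreal d"
    by auto
  have "disjoint_family_on C J"
    using J(2) C(1) by (fastforce simp: disjoint_family_on_def)
  from disjoint_closed_partition_of_unity[OF J(1) this compact_imp_closed[OF C(2)]]
  obtain f where f: "\<And>j. j \<in> J \<Longrightarrow> continuous_on UNIV (f j)" "\<And>j x. j \<in> J \<Longrightarrow> 0 \<le> f j x"
      "\<And>j x. j \<in> J \<Longrightarrow> x \<in> C j \<Longrightarrow> f j x = (1::real)"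
    and sum_f: "\<And>x. (\<Sum>j\<in>J. f j x) \<le> 1"
    by auto
  have "emeasure (evolve \<mu> (\<tau> j)) (A j) \<le> (\<integral>\<^sup>+x. ennreal (f j x) \<partial>evolve \<mu> (\<tau> j)) + ennreal d"
    if j: "j \<in> J" for j
  proof -
    have "emeasure (evolve \<mu> (\<tau> j)) (C j) = (\<integral>\<^sup>+x. indicator (C j) x \<partial>evolve \<mu> (\<tau> j))"
      using C(2)[OF j] by (simp add: sets_evolve[OF sets_mu] compact_imp_closed)
    also have "\<dots> \<le> (\<integral>\<^sup>+x. ennreal (f j x) \<partial>evolve \<mu> (\<tau> j))"
      using f(3)[OF j] by (intro nn_integral_mono) (auto split: split_indicator)
    finally show ?thesis
      using C(3)[OF j] by (meson add_right_mono order_trans)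
  qed
  then have "(\<Sum>j\<in>J. emeasure (evolve \<mu> (\<tau> j)) (A j)) \<le>
      (\<Sum>j\<in>J. (\<integral>\<^sup>+x. ennreal (f j x) \<partial>evolve \<mu> (\<tau> j)) + ennreal d)"
    by (intro sum_mono)
  also have "\<dots> = (\<Sum>j\<in>J. \<integral>\<^sup>+x. ennreal (f j x) \<partial>evolve \<mu> (\<tau> j)) + ennreal (real (card J) * d)"
    using d by (simp add: sum.distrib ennreal_mult ennreal_of_nat_eq_real_of_nat)
  also have "\<dots> \<le> 1 + ennreal e"
    using d sum_nn_integral_evolve_continuous_le[OF J(1) f(1,2) sum_f \<tau>]
    by (intro add_mono ennreal_leI) auto
  finally show "(\<Sum>j\<in>J. emeasure (evolve \<mu> (\<tau> j)) (A j)) \<le> 1 + ennreal e" .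
qed

text \<open>Testing weak convergence on the constant 1 shows that total masses converge, so the
  limit has mass at least 1/2; the strict inequality may be lost.\<close>

lemma emeasure_mu_pos:
  assumes "\<And>k. time_avg P \<nu> (T k) K > 1/2"
  shows "emeasure \<mu> UNIV > 0"
proof -
  interpret mu: finite_measure \<mu> by (rule finite_mu)
  have space_mu: "space \<mu> = UNIV"
    using sets_eq_imp_space_eq[OF sets_mu] by simp
  have "(\<lambda>k. \<integral>x. 1 \<partial>muK P \<nu> K (T k)) \<longlonglongrightarrow> (\<integral>x. (1::real) \<partial>\<mu>)"
    using weak_conv[unfolded weak_conv_meas_def, rule_format, of "\<lambda>_. 1"] by (simp add: image_constant_conv)
  moreover have "(\<integral>x. 1 \<partial>muK P \<nu> K (T k)) = time_avg P \<nu> (T k) K" for k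
  proof -
    have "measure (density (occupation \<nu> (T k)) (indicator K)) UNIV = measure (occupation \<nu> (T k)) K"
      using K by (simp add: measure_def emeasure_restricted sets_occupation[OF prob_nu sets_nu])
    then show ?thesis
      using K by (simp add: muK_eq_density_occupation[OF prob_nu sets_nu T_pos K]
          measure_occupation[OF prob_nu sets_nu T_pos K] space_occupation[OF prob_nu sets_nu])
  qed
  ultimately have "(\<lambda>k. time_avg P \<nu> (T k) K) \<longlonglongrightarrow> measure \<mu> UNIV"
    by (simp add: space_mu)
  then have "1/2 \<le> measure \<mu> UNIV"
    by (rule LIMSEQ_le_const) (use assms less_imp_le in blast)
  then show ?thesis
    by (simp add: mu.emeasure_eq_measure)
qed

end

section \<open>The tail suprema and their decreasing limit\<close>

context markov_transition
begin

text \<open>This is \<open>\<pi>\<^sub>r\<close> of the overview. The supremum is taken in the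
  lattice of measures, not set by set.\<close>

definition tail_sup :: "'a measure \<Rightarrow> real \<Rightarrow> 'a measure" where
  "tail_sup N r = (SUP t\<in>{r..}. evolve N t)"

context
  fixes N :: "'a measure"
  assumes sets_N [measurable_cong]: "sets N = sets borel"
begin

lemma sets_tail_sup: "sets (tail_sup N r) = sets borel"
  unfolding tail_sup_def by (intro sets_SUP sets_evolve[OF sets_N]) auto

lemma space_tail_sup: "space (tail_sup N r) = UNIV"
  using sets_eq_imp_space_eq[OF sets_tail_sup] by simp

lemma evolve_le_tail_sup: "r \<le> t \<Longrightarrow> evolve N t \<le> tail_sup N r"
  unfolding tail_sup_def by (intro SUP_upper) auto

lemma tail_sup_antimono: "r \<le> s \<Longrightarrow> tail_sup N s \<le> tail_sup N r"
  unfolding tail_sup_def by (intro SUP_subset_mono) auto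

text \<open>Each member at time \<open>t \<ge> r + s\<close> is the member at time
  \<open>t - s \<ge> r\<close> evolved by \<open>s\<close>, and evolution is monotone.\<close>

lemma tail_sup_add_le:
  assumes "0 \<le> r" "0 \<le> s"
  shows "tail_sup N (r + s) \<le> evolve (tail_sup N r) s"
  unfolding tail_sup_def[of N "r + s"]
proof (rule SUP_least)
  fix t assume "t \<in> {r + s..}"
  then have "evolve N t = evolve (evolve N (t - s)) s"
    using assms evolve_evolve[OF sets_N, of "t - s" s] by simp
  also have "\<dots> \<le> evolve (tail_sup N r) s"
    using \<open>t \<in> {r + s..}\<close>
    by (intro evolve_mono evolve_le_tail_sup sets_evolve sets_N sets_tail_sup) auto
  finally show "evolve N t \<le> evolve (tail_sup N r) s" .
qed

text \<open>The candidate is the setwise infimum of the tail suprema along integer times. Finiteness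
  of \<open>tail_sup N 0\<close> makes it a measure, conservation of mass keeps it nonzero, and
  subinvariance with equal masses makes it invariant.\<close>

lemma exists_invariant_measure_le_tail_sup:
  assumes pos: "emeasure N UNIV > 0" and fin: "emeasure (tail_sup N 0) UNIV < \<infinity>"
  shows "\<exists>\<eta>. invariant_measure P \<eta> \<and> \<eta> \<le> tail_sup N 0"
proof -
  let ?\<pi> = "\<lambda>n. tail_sup N (real n)"
  define h where "h A = (INF n. emeasure (?\<pi> n) A)" for A
  define \<eta> where "\<eta> = measure_of UNIV (sets borel) h"
  have \<pi>_mono: "emeasure (?\<pi> n) A \<le> emeasure (?\<pi> m) A" if "m \<le> n" for m n A
    using that by (intro le_measureD3 tail_sup_antimono) (auto simp: sets_tail_sup)
  have \<pi>_fin: "emeasure (?\<pi> n) A \<noteq> \<infinity>" for n A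
  proof -
    have "emeasure (?\<pi> n) A \<le> emeasure (tail_sup N 0) A"
      using \<pi>_mono[of 0 n A] by simp
    also have "\<dots> \<le> emeasure (tail_sup N 0) UNIV"
      by (intro emeasure_mono) (auto simp: sets_tail_sup)
    finally show ?thesis using fin by (auto simp: top_unique)
  qed
  have tendsto_h: "(\<lambda>n. emeasure (?\<pi> n) A) \<longlonglongrightarrow> h A" for A
    unfolding h_def by (intro LIMSEQ_INF) (auto simp: antimono_def \<pi>_mono)
  have h_le: "h A \<le> emeasure (?\<pi> n) A" for n A
    unfolding h_def by (intro INF_lower) auto
  have positive_h: "positive (sets borel) h"
    by (simp add: positive_def h_def)
  have "countably_additive (sets borel) h"
  \<comment> \<open>Additivity passes to the pointwise limit, and continuity at the empty set
    follows from domination by the finite measure \<open>?\<pi> 0\<close>.\<close>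
  proof (rule sets.empty_continuous_imp_countably_additive)
    show "additive (sets borel) h"
    unfolding additive_def
    proof (intro ballI impI)
      fix A B :: "'a set" assume "A \<in> sets borel" "B \<in> sets borel" "A \<inter> B = {}"
      then have "(\<lambda>n. emeasure (?\<pi> n) (A \<union> B)) = (\<lambda>n. emeasure (?\<pi> n) A + emeasure (?\<pi> n) B)"
        by (intro ext plus_emeasure[symmetric]) (auto simp: sets_tail_sup)
      then have "(\<lambda>n. emeasure (?\<pi> n) (A \<union> B)) \<longlonglongrightarrow> h A + h B"
        using tendsto_add[OF tendsto_h tendsto_h] by simp
      then show "h (A \<union> B) = h A + h B"
        using tendsto_h LIMSEQ_unique by blast
    qed
    show "\<forall>A\<in>sets borel. h A \<noteq> \<infinity>"
    proof
      fix A show "h A \<noteq> \<infinity>"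
        using h_le[of A 0] \<pi>_fin[of 0 A] by (auto simp: top_unique)
    qed
    fix A :: "nat \<Rightarrow> 'a set" assume A: "range A \<subseteq> sets borel" "decseq A" "(\<Inter>i. A i) = {}"
    have lim: "(\<lambda>i. emeasure (?\<pi> 0) (A i)) \<longlonglongrightarrow> 0"
      using Lim_emeasure_decseq[of A "?\<pi> 0"] A \<pi>_fin[of 0] by (simp add: sets_tail_sup)
    show "(\<lambda>i. h (A i)) \<longlonglongrightarrow> 0"
    proof (rule tendsto_sandwich[OF _ _ tendsto_const])
      show "\<forall>\<^sub>F i in sequentially. h (A i) \<le> emeasure (?\<pi> 0) (A i)"
        by (intro always_eventually allI h_le)
    qed (simp, rule lim)
  qed (rule positive_h)
  with positive_h have emeasure_\<eta>: "emeasure \<eta> A = h A" if "A \<in> sets borel" for A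
    using that sets.space_closed[of borel] sets.sigma_sets_eq[of "borel :: 'a measure"]
    by (intro emeasure_measure_of[OF \<eta>_def]) (auto simp: \<eta>_def)
  have sets_\<eta> [measurable_cong]: "sets \<eta> = sets borel"
    using sets.sigma_sets_eq[of "borel :: 'a measure"] by (simp add: \<eta>_def)
  have space_\<eta>: "space \<eta> = UNIV"
    using sets_eq_imp_space_eq[OF sets_\<eta>] by simp
  have \<eta>_le: "\<eta> \<le> ?\<pi> n" for n
    using h_le emeasure_\<eta> by (subst le_measure) (auto simp: sets_\<eta> sets_tail_sup)
  interpret \<eta>: finite_measure \<eta>
    using h_le[of UNIV 0] \<pi>_fin[of 0 UNIV]
    by (intro finite_measureI) (auto simp: space_\<eta> emeasure_\<eta> top_unique)
  \<comment> \<open>Every tail supremum dominates \<open>evolve N n\<close>, which has the mass of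
    \<open>N\<close>.\<close>
  have "emeasure N UNIV \<le> emeasure (?\<pi> n) UNIV" for n
    using le_measureD3[OF evolve_le_tail_sup[of n n], of UNIV] emeasure_evolve_UNIV[OF sets_N, of n]
    by (simp add: sets_tail_sup sets_evolve sets_N)
  then have "emeasure N UNIV \<le> emeasure \<eta> UNIV"
    by (auto simp: emeasure_\<eta> h_def intro: INF_greatest)
  with pos have \<eta>_pos: "emeasure \<eta> UNIV \<noteq> 0"
    by auto

  \<comment> \<open>Complements replace a limit theorem for evolved measures:
    \<open>evolve (?\<pi> n) s\<close> dominates \<open>evolve \<eta> s\<close> on
    \<open>- A\<close>, so its excess on \<open>A\<close> is at most the difference of total masses,
    which tends to 0. Masses are added on both sides to avoid subtraction in
    \<open>ennreal\<close>.\<close>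
  have \<eta>_le_evolve: "emeasure \<eta> A \<le> emeasure (evolve \<eta> s) A" if "0 \<le> s" and A: "A \<in> sets borel" for s A
  proof -
    have split: "emeasure (evolve M s) A + emeasure (evolve M s) (- A) = emeasure M UNIV"
      if "sets M = sets borel" for M
      using A that by (subst plus_emeasure) (auto simp: sets_evolve emeasure_evolve_UNIV Compl_partition)
    have "emeasure \<eta> A + emeasure \<eta> UNIV \<le> emeasure (evolve \<eta> s) A + emeasure (?\<pi> n) UNIV" for n
    proof -
      \<comment> \<open>Rounding up is needed because \<open>\<eta>\<close> has been compared only
        with integer times.\<close>
      have "emeasure \<eta> A \<le> emeasure (?\<pi> (nat \<lceil>real n + s\<rceil>)) A"
        by (intro le_measureD3 \<eta>_le) (simp add: sets_\<eta> sets_tail_sup)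
      also have "\<dots> \<le> emeasure (tail_sup N (real n + s)) A"
        by (intro le_measureD3 tail_sup_antimono) (auto simp: sets_tail_sup real_nat_ceiling_ge)
      also have "\<dots> \<le> emeasure (evolve (?\<pi> n) s) A"
        using \<open>0 \<le> s\<close> by (intro le_measureD3 tail_sup_add_le) (auto simp: sets_tail_sup sets_evolve)
      finally have 1: "emeasure \<eta> A \<le> emeasure (evolve (?\<pi> n) s) A" .
      have "emeasure (evolve \<eta> s) (- A) \<le> emeasure (evolve (?\<pi> n) s) (- A)"
        by (intro le_measureD3 evolve_mono \<eta>_le) (auto simp: sets_evolve sets_\<eta> sets_tail_sup)
      then have "emeasure \<eta> A + emeasure \<eta> UNIV \<le>
          emeasure (evolve (?\<pi> n) s) A + (emeasure (evolve \<eta> s) A + emeasure (evolve (?\<pi> n) s) (- A))"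
        unfolding split[OF sets_\<eta>, symmetric] by (intro add_mono 1 order_refl)
      also have "\<dots> = emeasure (evolve \<eta> s) A + emeasure (?\<pi> n) UNIV"
        unfolding split[OF sets_tail_sup, symmetric] by (simp add: ac_simps)
      finally show ?thesis .
    qed
    then have "emeasure \<eta> A + emeasure \<eta> UNIV \<le> emeasure (evolve \<eta> s) A + h UNIV"
      by (intro LIMSEQ_le_const[OF tendsto_add[OF tendsto_const tendsto_h]]) auto
    then show ?thesis
      using \<eta>.emeasure_finite[of UNIV]
      by (simp add: emeasure_\<eta> add.commute[of _ "h UNIV"] ennreal_add_left_cancel_le)
  qed
  have evolve_\<eta>: "evolve \<eta> s = \<eta>" if "0 \<le> s" for s
  proof (rule measure_eqI)
    show "sets (evolve \<eta> s) = sets \<eta>"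
      by (simp add: sets_evolve sets_\<eta>)
    fix A assume "A \<in> sets (evolve \<eta> s)"
    then have A: "A \<in> sets borel" "- A \<in> sets borel"
      by (auto simp: sets_evolve sets_\<eta>)
    interpret E: finite_measure "evolve \<eta> s"
      by (intro finite_measure_evolve sets_\<eta> \<eta>.finite_measure_axioms)
    \<comment> \<open>The inequality on \<open>A\<close> and on its complement, with equal total
      masses, leaves only equality.\<close>
    have "measure \<eta> A \<le> measure (evolve \<eta> s) A" "measure \<eta> (- A) \<le> measure (evolve \<eta> s) (- A)"
      using A \<eta>_le_evolve[OF that] by (auto simp: \<eta>.emeasure_eq_measure E.emeasure_eq_measure)
    moreover have "measure \<eta> (- A) = measure \<eta> UNIV - measure \<eta> A"
      using A \<eta>.finite_measure_compl[of A] by (simp add: sets_\<eta> space_\<eta> Compl_eq_Diff_UNIV)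
    moreover have "measure (evolve \<eta> s) (- A) = measure \<eta> UNIV - measure (evolve \<eta> s) A"
      using A E.finite_measure_compl[of A] emeasure_evolve_UNIV[OF sets_\<eta>]
      by (simp add: sets_evolve sets_\<eta> space_evolve Compl_eq_Diff_UNIV measure_def)
    ultimately show "emeasure (evolve \<eta> s) A = emeasure \<eta> A"
      by (simp add: \<eta>.emeasure_eq_measure E.emeasure_eq_measure)
  qed
  have "(\<integral>x. (\<integral>y. f y \<partial>P t x) \<partial>\<eta>) = (\<integral>x. f x \<partial>\<eta>)"
    if f: "t > 0" "f \<in> borel_measurable borel" "bounded (range f)" for t and f :: "'a \<Rightarrow> real"
  proof -
    obtain B where "\<And>x. \<bar>f x\<bar> \<le> B"
      using f(3) by (auto simp: bounded_iff)
    then have "(\<integral>x. f x \<partial>(\<eta> \<bind> Q t)) = (\<integral>x. (\<integral>y. f y \<partial>Q t x) \<partial>\<eta>)"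
      using f by (intro integral_bind[where K=borel and B=B and B'=1] \<eta>.finite_measure_axioms) auto
    then show ?thesis
      using f evolve_\<eta>[of t] by (simp add: evolve_def Q_eq)
  qed
  then have "invariant_measure P \<eta>"
    using \<eta>_pos sets_\<eta> space_\<eta> \<eta>.finite_measure_axioms by (auto simp: invariant_measure_def)
  then show ?thesis
    using \<eta>_le[of 0] by auto
qed

end

text \<open>A finite \<open>\<mu>\<close> may have mass above 1, outside the space of
  subprobabilities, so measurability in time comes from integrating a jointly measurable
  function.\<close>

lemma measurable_nn_integral_evolve:
  assumes fin_mu: "finite_measure \<mu>" and sets_mu [measurable_cong]: "sets \<mu> = sets borel"
    and [measurable]: "f \<in> borel_measurable borel"
  shows "(\<lambda>s. \<integral>\<^sup>+x. f x \<partial>evolve \<mu> s) \<in> borel_measurable borel"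
proof -
  interpret finite_measure \<mu> by (rule fin_mu)
  show ?thesis
    by (subst nn_integral_evolve[OF sets_mu]) measurable
qed

section \<open>The resolvent measure as an exponential mixture of evolved measures\<close>

context
  fixes \<mu> :: "'a measure" and \<alpha> :: real
  assumes fin_mu: "finite_measure \<mu>" and sets_mu [measurable_cong]: "sets \<mu> = sets borel"
    and \<alpha>: "\<alpha> > 0"
begin

text \<open>The weight \<open>\<alpha> exp (- \<alpha> s)\<close> is the density of an exponential
  time, so \<open>\<alpha> R\<^sub>\<alpha>\<close> is evolution up to such a time. The bind form
  shows that the defining set function is a measure, and Tonelli exchanges time and space.\<close>

lemma resolvent_measure_eq_bind:
  "resolvent_measure P \<alpha> \<mu> =
    \<mu> \<bind> (\<lambda>x. density lborel (exponential_density \<alpha>) \<bind> (\<lambda>s. Q s x))" (is "_ = ?m")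
  and sets_resolvent_measure: "sets (resolvent_measure P \<alpha> \<mu>) = sets borel"
  and nn_integral_resolvent_measure:
  "f \<in> borel_measurable borel \<Longrightarrow> (\<integral>\<^sup>+x. f x \<partial>resolvent_measure P \<alpha> \<mu>) =
    (\<integral>\<^sup>+s. ennreal (exponential_density \<alpha> s) * (\<integral>\<^sup>+x. f x \<partial>evolve \<mu> s) \<partial>lborel)"
proof -
  interpret mu: finite_measure \<mu> by (rule fin_mu)
  interpret pair_sigma_finite lborel \<mu> ..
  let ?X = "density lborel (exponential_density \<alpha>)"
  let ?R = "\<lambda>x. ?X \<bind> (\<lambda>s. Q s x)"
  have X: "?X \<in> space (subprob_algebra borel)"
    using prob_space_exponential_density[OF \<alpha>]
    by (simp add: space_subprob_algebra prob_space_imp_subprob_space)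
  then have R [measurable]: "?R \<in> borel \<rightarrow>\<^sub>M subprob_algebra borel"
    by (intro measurable_bind[where N=borel]) auto
  have nn_R: "(\<integral>\<^sup>+y. f y \<partial>?R x) = (\<integral>\<^sup>+s. ennreal (exponential_density \<alpha> s) * (\<integral>\<^sup>+y. f y \<partial>Q s x) \<partial>lborel)"
    if [measurable]: "f \<in> borel_measurable borel" for f x
    by (subst nn_integral_bind[where B=borel]) (auto intro!: nn_integral_density)
  have nn_m: "(\<integral>\<^sup>+x. f x \<partial>?m) = (\<integral>\<^sup>+x. (\<integral>\<^sup>+s. ennreal (exponential_density \<alpha> s) * (\<integral>\<^sup>+y. f y \<partial>Q s x) \<partial>lborel) \<partial>\<mu>)"
    if [measurable]: "f \<in> borel_measurable borel" for f
    by (subst nn_integral_bind[where B=borel]) (auto simp: nn_R)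
  have space_mu: "space \<mu> = UNIV"
    using sets_eq_imp_space_eq[OF sets_mu] by simp
  have sets_R: "sets (?R x) = sets borel" for x
    by (subst sets_bind[where N=borel]) auto
  have sets_m: "sets ?m = sets borel"
    by (subst sets_bind[where N=borel]) (auto simp: space_mu sets_R)
  have "?m = measure_of UNIV (sets borel) (emeasure ?m)"
    using measure_of_of_measure[of ?m] sets_eq_imp_space_eq[OF sets_m] by (simp add: sets_m)
  also have "\<dots> = resolvent_measure P \<alpha> \<mu>"
    unfolding resolvent_measure_def
  proof (rule measure_of_eq)
    fix A assume "A \<in> sigma_sets UNIV (sets (borel :: 'a measure))"
    then have A [measurable]: "A \<in> sets borel"
      using sets.sigma_sets_eq[of "borel :: 'a measure"] by simp
    have "emeasure ?m A = (\<integral>\<^sup>+x. (\<integral>\<^sup>+s. ennreal (exponential_density \<alpha> s) * (\<integral>\<^sup>+y. indicator A y \<partial>Q s x) \<partial>lborel) \<partial>\<mu>)"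
      using nn_m[of "indicator A"] by (simp add: sets_m)
    also have "\<dots> = (\<integral>\<^sup>+x. ennreal \<alpha> * resolvent P \<alpha> (indicator A) x \<partial>\<mu>)"
    proof (intro nn_integral_cong)
      fix x
      have "(\<integral>\<^sup>+s. ennreal (exponential_density \<alpha> s) * (\<integral>\<^sup>+y. indicator A y \<partial>Q s x) \<partial>lborel) =
          (\<integral>\<^sup>+s. ennreal \<alpha> * (ennreal (exp (- \<alpha> * s)) * (\<integral>\<^sup>+y. indicator A y \<partial>Q s x) * indicator {0..} s) \<partial>lborel)"
        using \<alpha> by (intro nn_integral_cong)
          (auto simp: exponential_density_def ennreal_mult mult_ac split: split_indicator)
      also have "\<dots> = ennreal \<alpha> * (\<integral>\<^sup>+s. ennreal (exp (- \<alpha> * s)) * (\<integral>\<^sup>+y. indicator A y \<partial>Q s x) * indicator {0..} s \<partial>lborel)"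
        by (intro nn_integral_cmult) measurable
      also have "(\<integral>\<^sup>+s. ennreal (exp (- \<alpha> * s)) * (\<integral>\<^sup>+y. indicator A y \<partial>Q s x) * indicator {0..} s \<partial>lborel) =
          resolvent P \<alpha> (indicator A) x"
        unfolding resolvent_def
        by (intro nn_integral_cong) (auto simp: Q_eq simp del: nn_integral_indicator split: split_indicator)
      finally show "(\<integral>\<^sup>+s. ennreal (exponential_density \<alpha> s) * (\<integral>\<^sup>+y. indicator A y \<partial>Q s x) \<partial>lborel) =
        ennreal \<alpha> * resolvent P \<alpha> (indicator A) x" .
    qed
    finally show "emeasure ?m A = (\<integral>\<^sup>+x. ennreal \<alpha> * resolvent P \<alpha> (indicator A) x \<partial>\<mu>)" .
  qed simp
  finally show eq: "resolvent_measure P \<alpha> \<mu> = ?m" ..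
  show "sets (resolvent_measure P \<alpha> \<mu>) = sets borel"
    unfolding eq by (rule sets_m)
  assume f [measurable]: "f \<in> borel_measurable borel"
  have "(\<integral>\<^sup>+x. f x \<partial>resolvent_measure P \<alpha> \<mu>) =
      (\<integral>\<^sup>+s. (\<integral>\<^sup>+x. ennreal (exponential_density \<alpha> s) * (\<integral>\<^sup>+y. f y \<partial>Q s x) \<partial>\<mu>) \<partial>lborel)"
    unfolding eq nn_m[OF f] by (intro Fubini') measurable
  also have "\<dots> = (\<integral>\<^sup>+s. ennreal (exponential_density \<alpha> s) * (\<integral>\<^sup>+x. f x \<partial>evolve \<mu> s) \<partial>lborel)"
    by (intro nn_integral_cong) (simp add: nn_integral_evolve[OF sets_mu] nn_integral_cmult)
  finally show "(\<integral>\<^sup>+x. f x \<partial>resolvent_measure P \<alpha> \<mu>) =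
      (\<integral>\<^sup>+s. ennreal (exponential_density \<alpha> s) * (\<integral>\<^sup>+x. f x \<partial>evolve \<mu> s) \<partial>lborel)" .
qed

lemma nn_integral_exponential_density: "(\<integral>\<^sup>+s. ennreal (exponential_density \<alpha> s) \<partial>lborel) = 1"
  using prob_space.emeasure_space_1[OF prob_space_exponential_density[OF \<alpha>]] by (simp add: emeasure_density)

lemma emeasure_resolvent_measure_UNIV: "emeasure (resolvent_measure P \<alpha> \<mu>) UNIV = emeasure \<mu> UNIV"
proof -
  have "emeasure (resolvent_measure P \<alpha> \<mu>) UNIV =
      (\<integral>\<^sup>+s. ennreal (exponential_density \<alpha> s) * emeasure \<mu> UNIV \<partial>lborel)"
    using nn_integral_resolvent_measure[of "\<lambda>_. 1"] sets_eq_imp_space_eq[OF sets_resolvent_measure]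
    by (simp add: space_evolve[OF sets_mu] emeasure_evolve_UNIV[OF sets_mu])
  then show ?thesis
    by (simp add: nn_integral_multc nn_integral_exponential_density)
qed

lemma nn_integral_evolve_resolvent_measure:
  assumes "t \<ge> 0" and f [measurable]: "f \<in> borel_measurable borel"
  shows "(\<integral>\<^sup>+x. f x \<partial>evolve (resolvent_measure P \<alpha> \<mu>) t) =
    (\<integral>\<^sup>+s. ennreal (exponential_density \<alpha> s) * (\<integral>\<^sup>+x. f x \<partial>evolve \<mu> (s + t)) \<partial>lborel)"
proof -
  have "(\<integral>\<^sup>+x. f x \<partial>evolve (resolvent_measure P \<alpha> \<mu>) t) =
      (\<integral>\<^sup>+s. ennreal (exponential_density \<alpha> s) * (\<integral>\<^sup>+x. (\<integral>\<^sup>+y. f y \<partial>Q t x) \<partial>evolve \<mu> s) \<partial>lborel)"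
    by (simp add: nn_integral_evolve[OF sets_resolvent_measure] nn_integral_resolvent_measure)
  also have "\<dots> = (\<integral>\<^sup>+s. ennreal (exponential_density \<alpha> s) * (\<integral>\<^sup>+x. f x \<partial>evolve \<mu> (s + t)) \<partial>lborel)"
  proof (intro nn_integral_cong)
    fix s :: real
    show "ennreal (exponential_density \<alpha> s) * (\<integral>\<^sup>+x. (\<integral>\<^sup>+y. f y \<partial>Q t x) \<partial>evolve \<mu> s) =
        ennreal (exponential_density \<alpha> s) * (\<integral>\<^sup>+x. f x \<partial>evolve \<mu> (s + t))"
    \<comment> \<open>The semigroup law covers \<open>s \<ge> 0\<close>; for negative
      \<open>s\<close> the density is 0.\<close>
    proof (cases "s < 0")
      case False
      then have "evolve \<mu> (s + t) = evolve (evolve \<mu> s) t"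
        using assms evolve_evolve[OF sets_mu, of s t] by simp
      then show ?thesis
        by (simp add: nn_integral_evolve[OF sets_evolve[OF sets_mu]])
    qed (simp add: exponential_density_def)
  qed
  finally show ?thesis .
qed

text \<open>Delaying an exponential time by \<open>t\<close> multiplies its density by
  \<open>exp (\<alpha> * t)\<close> beyond \<open>t\<close> and removes the part before, so the
  delayed law is at most that multiple of the original.\<close>

lemma nn_integral_evolve_resolvent_measure_le:
  assumes "t \<ge> 0" and f [measurable]: "f \<in> borel_measurable borel"
  shows "(\<integral>\<^sup>+x. f x \<partial>evolve (resolvent_measure P \<alpha> \<mu>) t) \<le>
    ennreal (exp (\<alpha> * t)) * (\<integral>\<^sup>+x. f x \<partial>resolvent_measure P \<alpha> \<mu>)"
proof -
  define \<phi> where "\<phi> s = (\<integral>\<^sup>+x. f x \<partial>evolve \<mu> s)" for s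
  have [measurable]: "\<phi> \<in> borel_measurable borel"
    unfolding \<phi>_def by (rule measurable_nn_integral_evolve[OF fin_mu sets_mu f])
  have density_le: "exponential_density \<alpha> s \<le> exp (\<alpha> * t) * exponential_density \<alpha> (t + s)" for s
    using \<alpha> \<open>t \<ge> 0\<close> by (auto simp: exponential_density_def algebra_simps simp flip: exp_add)
  have "(\<integral>\<^sup>+x. f x \<partial>evolve (resolvent_measure P \<alpha> \<mu>) t) =
      (\<integral>\<^sup>+s. ennreal (exponential_density \<alpha> s) * \<phi> (t + s) \<partial>lborel)"
    using assms by (simp add: nn_integral_evolve_resolvent_measure \<phi>_def add.commute)
  also have "\<dots> \<le> (\<integral>\<^sup>+s. ennreal (exp (\<alpha> * t)) * (ennreal (exponential_density \<alpha> (t + s)) * \<phi> (t + s)) \<partial>lborel)"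
  proof (intro nn_integral_mono)
    fix s :: real
    have "ennreal (exponential_density \<alpha> s) \<le> ennreal (exp (\<alpha> * t)) * ennreal (exponential_density \<alpha> (t + s))"
      using density_le[of s] by (simp add: ennreal_leI flip: ennreal_mult')
    then show "ennreal (exponential_density \<alpha> s) * \<phi> (t + s) \<le>
        ennreal (exp (\<alpha> * t)) * (ennreal (exponential_density \<alpha> (t + s)) * \<phi> (t + s))"
      by (simp add: mult_right_mono flip: mult.assoc)
  qed
  also have "\<dots> = ennreal (exp (\<alpha> * t)) * (\<integral>\<^sup>+s. ennreal (exponential_density \<alpha> (t + s)) * \<phi> (t + s) \<partial>lborel)"
    by (intro nn_integral_cmult) measurable
  also have "(\<integral>\<^sup>+s. ennreal (exponential_density \<alpha> (t + s)) * \<phi> (t + s) \<partial>lborel) =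
      (\<integral>\<^sup>+s. ennreal (exponential_density \<alpha> s) * \<phi> s \<partial>lborel)"
    using nn_integral_real_affine[of "\<lambda>s. ennreal (exponential_density \<alpha> s) * \<phi> s" 1 t] by simp
  finally show ?thesis
    by (simp add: nn_integral_resolvent_measure \<phi>_def)
qed

end

end

section \<open>Mass bound for the tail supremum of the resolvent measure\<close>

context occupation_limit
begin

text \<open>For disjoint cells, the sum to be bounded is an exponential average over
  \<open>s\<close> of the corresponding sums for \<open>\<mu>\<close> with all times shifted by
  \<open>s\<close>. Each of these is at most 1, since shifted times stay nonnegative and the cells
  stay disjoint.\<close>

lemma emeasure_tail_sup_resolvent_measure_le:
  assumes \<alpha>: "\<alpha> > 0"
  shows "emeasure (tail_sup (resolvent_measure P \<alpha> \<mu>) 0) UNIV \<le> 1"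
proof -
  let ?m = "resolvent_measure P \<alpha> \<mu>"
  note sets_m = sets_resolvent_measure[OF finite_mu sets_mu \<alpha>]
  have fin_m: "finite_measure ?m"
    using emeasure_resolvent_measure_UNIV[OF finite_mu sets_mu \<alpha>] sets_eq_imp_space_eq[OF sets_m]
      finite_measure.emeasure_finite[OF finite_mu]
    by (intro finite_measureI) simp
  have "emeasure (SUP t\<in>{0..}. evolve ?m t) (space borel) \<le> 1"
  proof (rule emeasure_SUP_space_le)
    fix J and D :: "real \<Rightarrow> 'a set"
    assume J: "finite J" "J \<subseteq> {0..}" "disjoint_family_on D J" "D ` J \<subseteq> sets borel"
    have eq: "emeasure (evolve ?m t) (D t) =
        (\<integral>\<^sup>+s. ennreal (exponential_density \<alpha> s) * emeasure (evolve \<mu> (s + t)) (D t) \<partial>lborel)" if "t \<in> J" for t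
      using nn_integral_evolve_resolvent_measure[OF finite_mu sets_mu \<alpha>, of t "indicator (D t)"] that J
      by (auto simp: sets_evolve sets_m sets_mu)
    have meas [measurable]: "(\<lambda>s. emeasure (evolve \<mu> (s + t)) (D t)) \<in> borel_measurable borel" if "t \<in> J" for t
    proof -
      have "(\<lambda>s. \<integral>\<^sup>+x. indicator (D t) x \<partial>evolve \<mu> s) \<in> borel_measurable borel"
        using that J by (intro measurable_nn_integral_evolve[OF finite_mu sets_mu]) auto
      moreover have "(\<lambda>s. \<integral>\<^sup>+x. indicator (D t) x \<partial>evolve \<mu> s) = (\<lambda>s. emeasure (evolve \<mu> s) (D t))"
        using that J by (auto simp: sets_evolve sets_mu)
      ultimately have [measurable]: "(\<lambda>s. emeasure (evolve \<mu> s) (D t)) \<in> borel_measurable borel"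
        by simp
      show ?thesis by measurable
    qed
    have "(\<Sum>t\<in>J. emeasure (evolve ?m t) (D t)) =
        (\<integral>\<^sup>+s. (\<Sum>t\<in>J. ennreal (exponential_density \<alpha> s) * emeasure (evolve \<mu> (s + t)) (D t)) \<partial>lborel)"
      using eq by (subst nn_integral_sum) auto
    also have "\<dots> \<le> (\<integral>\<^sup>+s. ennreal (exponential_density \<alpha> s) \<partial>lborel)"
    proof (intro nn_integral_mono)
      fix s :: real
      show "(\<Sum>t\<in>J. ennreal (exponential_density \<alpha> s) * emeasure (evolve \<mu> (s + t)) (D t))
          \<le> ennreal (exponential_density \<alpha> s)"
      proof (cases "s < 0")
        case False
        then have "(\<Sum>t\<in>J. emeasure (evolve \<mu> (s + t)) (D t)) \<le> 1"
          using J by (intro sum_emeasure_evolve_disjoint_le) auto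
        then show ?thesis
          unfolding sum_distrib_left[symmetric] using mult_left_mono by fastforce
      qed (simp add: exponential_density_def)
    qed
    also have "\<dots> = 1"
      by (rule nn_integral_exponential_density[OF finite_mu sets_mu \<alpha>])
    finally show "(\<Sum>t\<in>J. emeasure (evolve ?m t) (D t)) \<le> 1" .
  qed (simp_all add: finite_measure_evolve sets_evolve sets_m fin_m)
  then show ?thesis
    by (simp add: tail_sup_def)
qed

end

section \<open>Almost invariance and the absolutely continuous invariant measure\<close>

theorem theorem3p3:
  fixes P :: "real \<Rightarrow> 'a::polish_space \<Rightarrow> 'a measure"
    and K :: "'a set" and \<nu> \<mu> :: "'a measure"
    and t :: "nat \<Rightarrow> real" and r :: "nat \<Rightarrow> nat" and \<alpha> :: real
  assumes "markov_tf P" and "feller P"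
    and "compact K"
    and "prob_space \<nu>" and "sets \<nu> = sets borel"
    and "Limsup at_top (\<lambda>T. ereal (time_avg P \<nu> T K)) > 1/2"
    and "strict_mono t" and "filterlim t at_top sequentially" and "\<And>n. t n > 0"
    and "\<And>n. time_avg P \<nu> (t n) K > 1/2"
    and "strict_mono r"
    and "finite_measure \<mu>" and "sets \<mu> = sets borel"
    and "weak_conv_meas (\<lambda>k. muK P \<nu> K (t (r k))) \<mu>"
    and "\<alpha> > 0"
  shows "almost_invariant P (resolvent_measure P \<alpha> \<mu>) \<and>
         (\<exists>\<eta>. invariant_measure P \<eta> \<and> absolutely_continuous (resolvent_measure P \<alpha> \<mu>) \<eta>)"
proof -
  have K: "K \<in> sets borel"
    using assms(3) by (intro borel_closed compact_imp_closed)
  have t: "filterlim (\<lambda>k. t (r k)) at_top sequentially"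
    using assms(8) filterlim_subseq[OF assms(11)] by (rule filterlim_compose)
  interpret occupation_limit P \<nu> \<mu> K "\<lambda>k. t (r k)"
    by (intro occupation_limit.intro markov_transition.intro occupation_limit_axioms.intro)
      (rule assms K t)+
  let ?m = "resolvent_measure P \<alpha> \<mu>"
  let ?\<pi> = "tail_sup ?m 0"
  have sets_m: "sets ?m = sets borel"
    and mass_m: "emeasure ?m UNIV = emeasure \<mu> UNIV"
    and evolve_m_le: "\<And>s f. 0 \<le> s \<Longrightarrow> f \<in> borel_measurable borel \<Longrightarrow>
      (\<integral>\<^sup>+x. f x \<partial>evolve ?m s) \<le> ennreal (exp (\<alpha> * s)) * (\<integral>\<^sup>+x. f x \<partial>?m)"
    using sets_resolvent_measure[OF finite_mu sets_mu \<open>\<alpha> > 0\<close>]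
      emeasure_resolvent_measure_UNIV[OF finite_mu sets_mu \<open>\<alpha> > 0\<close>]
      nn_integral_evolve_resolvent_measure_le[OF finite_mu sets_mu \<open>\<alpha> > 0\<close>] by auto
  have space_m: "space ?m = UNIV"
    using sets_eq_imp_space_eq[OF sets_m] by simp
  have fin_m: "finite_measure ?m"
    using finite_measure.emeasure_finite[OF finite_mu]
    by (intro finite_measureI) (simp add: space_m mass_m)
  have mass_\<pi>: "emeasure ?\<pi> UNIV \<le> 1"
    by (rule emeasure_tail_sup_resolvent_measure_le) fact
  then interpret \<pi>: finite_measure ?\<pi>
    by (intro finite_measureI) (auto simp: space_tail_sup[OF sets_m] top_unique)
  have ac: "absolutely_continuous ?m ?\<pi>"
    unfolding absolutely_continuous_def
  proof
    fix A assume A: "A \<in> null_sets ?m"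
    then have "A \<in> sets borel"
      by (auto simp: sets_m)
    \<comment> \<open>The factor \<open>exp (\<alpha> * s)\<close> is unbounded in \<open>s\<close>,
      but it is finite for each \<open>s\<close>, which is enough for null sets.\<close>
    then have "emeasure (evolve ?m s) A = 0" if "0 \<le> s" for s
      using evolve_m_le[OF that, of "indicator A"] A by (simp add: sets_m sets_evolve null_setsD1)
    with \<open>A \<in> sets borel\<close> show "A \<in> null_sets ?\<pi>"
      unfolding tail_sup_def
      by (intro null_sets_SUP_measure[where N=borel] null_setsI) (auto simp: sets_evolve[OF sets_m])
  qed
  have null_clause: "(\<integral>\<^sup>+x. (\<integral>\<^sup>+y. f y \<partial>P s x) \<partial>?m) = 0"
    if "0 < s" "f \<in> borel_measurable borel" "(\<integral>\<^sup>+x. f x \<partial>?m) = 0" for s f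
    using evolve_m_le[of s f] that by (simp add: nn_integral_evolve[OF sets_m] Q_eq)
  have small: "\<exists>\<eta>>0. \<forall>A\<in>sets borel. measure ?m A < \<eta> \<longrightarrow> measure ?\<pi> A < \<epsilon>" if "0 < \<epsilon>" for \<epsilon>
    using absolutely_continuous_small_sets[OF fin_m \<pi>.finite_measure_axioms ac _ that]
    by (simp add: sets_m sets_tail_sup[OF sets_m])
  have bound: "(\<integral>\<^sup>+x. emeasure (P s x) A \<partial>?m) \<le> ennreal (measure ?\<pi> A)"
    if "0 < s" "A \<in> sets borel" for s A
  proof -
    have "(\<integral>\<^sup>+x. emeasure (P s x) A \<partial>?m) = emeasure (evolve ?m s) A"
      using that by (simp add: emeasure_evolve[OF sets_m] Q_eq)
    also have "\<dots> \<le> emeasure ?\<pi> A"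
      using that by (intro le_measureD3 evolve_le_tail_sup) (auto simp: sets_m sets_evolve sets_tail_sup)
    finally show ?thesis
      by (simp add: \<pi>.emeasure_eq_measure)
  qed
  have almost_inv: "almost_invariant P ?m"
    unfolding almost_invariant_def
  proof (intro conjI)
    show "\<exists>\<delta>::real. 0 \<le> \<delta> \<and> \<delta> < 1 \<and> (\<exists>\<phi>::'a set \<Rightarrow> real. (\<forall>A\<in>sets borel. 0 \<le> \<phi> A) \<and>
        (\<forall>\<epsilon>>0. \<exists>\<eta>>0. \<forall>A\<in>sets borel. measure ?m A < \<eta> \<longrightarrow> \<phi> A < \<epsilon>) \<and>
        (\<forall>t>0. \<forall>A\<in>sets borel. (\<integral>\<^sup>+x. emeasure (P t x) A \<partial>?m) \<le> ennreal (\<delta> * measure ?m (space ?m) + \<phi> A)))"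
      using small bound by (intro exI[of _ "0::real"] exI[of _ "measure ?\<pi>"] conjI) simp_all
  qed (use sets_m fin_m null_clause in auto)
  have "emeasure \<mu> UNIV > 0"
    by (rule emeasure_mu_pos) (rule assms(10))
  then obtain \<eta> where \<eta>: "invariant_measure P \<eta>" "\<eta> \<le> ?\<pi>"
    using exists_invariant_measure_le_tail_sup[OF sets_m] mass_m mass_\<pi>
    by (auto simp: order_le_less_trans)
  have "absolutely_continuous ?m \<eta>"
    unfolding absolutely_continuous_def
  proof
    fix A assume A: "A \<in> null_sets ?m"
    have sets_\<eta>: "sets \<eta> = sets borel"
      using \<eta>(1) by (simp add: invariant_measure_def)
    have "emeasure \<eta> A \<le> emeasure ?\<pi> A"
      using \<eta>(2) by (rule le_measureD3) (simp add: sets_\<eta> sets_tail_sup[OF sets_m])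
    also have "\<dots> = 0"
      using ac A by (auto simp: absolutely_continuous_def)
    finally show "A \<in> null_sets \<eta>"
      using A by (intro null_setsI) (auto simp: sets_\<eta> sets_m)
  qed
  with \<eta>(1) almost_inv show ?thesis
    by blast
qed

end
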